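(* Let $G$ be a countably infinite amenable group, let $\mathcal A_W$ be a finite alphabet, and let $W\subset \mathcal A_W^G$ be a sofic shift. For every $\varepsilon>0$ there exist an SFT $\tilde X$ (over $G$, over some finite alphabet) and a one-block code $\tilde\phi:\tilde X\to W$ such that the maximal entropy gap of $\tilde\phi$ satisfies $\mathcal H(\tilde\phi)<\varepsilon$.
   Context: Let $G$ be a countably infinite group. A Følner sequence for $G$ is a sequence $(F_n)_n$ of finite subsets of $G$ such that each $g\in G$ lies in $F_n$ for all sufficiently large $n$, and $\lim_{n\to\infty} |KF_n \triangle F_n|/|F_n| = 0$ for every finite $K\subset G$, where $KF=\{kf: k\in K, f\in F\}$. $G$ is amenable if such a sequence exists. For a finite set $\mathcal A$ (alphabet, discrete topology), $\mathcal A^G$ carries the product topology and the $G$-action $(\sigma^g x)_h = x_{hg}$ for $g,h\in G$. A subshift is a closed subset $X\subset \mathcal A^G$ with $\sigma^g x\in X$ for all $x\in X$, $g\in G$ (the empty set is allowed). A pattern is a function $p:F\to\mathcal A$ with $F\subset G$ finite; it occurs in $x$ if $(\sigma^g x)|_F = p$ for some $g\in G$. $X\subset\mathcal A^G$ is a shift of finite type (SFT) if there is a finite collection $\mathcal F$ of patterns such that $X$ is the set of all $x\in\mathcal A^G$ in which no $p\in\mathcal F$ occurs. A factor map between subshifts is a continuous surjection commuting with all $\sigma^g$. A subshift $W$ is sofic if there is an SFT $X$ and a factor map $X\to W$. A one-block code $\phi:X\to W$, for $X\subset\mathcal A_X^G$ and $W\subset\mathcal A_W^G$, is a factor map (in particular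 surjective) for which there is a function $\Phi:\mathcal A_X\to\mathcal A_W$ with $\phi(x)_g=\Phi(x_g)$ for all $x\in X$, $g\in G$. For finite $F\subset G$, let $\mathcal P(F,X)=\{(\sigma^g x)|_F : x\in X, g\in G\}$. The entropy of a nonempty subshift is $h(X)=\lim_{n\to\infty}\frac{1}{|F_n|}\log|\mathcal P(F_n,X)|$ (the limit exists and does not depend on the Følner sequence); by convention $h(\varnothing)=0$. The maximal entropy gap of a factor map $\phi:X\to W$ is $\mathcal H(\phi)=\sup_{X'}\big(h(X')-h(\phi(X'))\big)$, the supremum being over all subshifts $X'\subset X$. *)

theory Defs
  imports "HOL-Analysis.Analysis"
begin

text \<open>
  The group is a type of class \<open>group_add\<close>, which is not assumed commutative: the product
  \<open>gh\<close> of the multiplicative notation is written \<open>g + h\<close>. Alphabets are finite sets of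
  symbols, so that one can quantify over them; where an alphabet is existentially quantified, its
  symbols are natural numbers, which loses nothing as every finite alphabet can be renamed to a
  finite set of naturals.
\<close>

definition folner_sequence :: "(nat \<Rightarrow> 'g::group_add set) \<Rightarrow> bool" where
  (* K ranges over nonempty sets: for K = {} the quotient would be constantly 1. *)
  "folner_sequence F \<longleftrightarrow>
     (\<forall>n. finite (F n)) \<and>
     (\<forall>g. \<forall>\<^sub>F n in sequentially. g \<in> F n) \<and>
     (\<forall>K. finite K \<and> K \<noteq> {} \<longrightarrow>
        (\<lambda>n. let KF = {k + f | k f. k \<in> K \<and> f \<in> F n} in
              real (card ((KF - F n) \<union> (F n - KF))) / real (card (F n))) \<longlonglongrightarrow> 0)"

definition amenable :: "'g::group_add itself \<Rightarrow> bool" where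
  "amenable _ \<longleftrightarrow> (\<exists>F :: nat \<Rightarrow> 'g set. folner_sequence F)"

definition full_shift :: "'a set \<Rightarrow> ('g \<Rightarrow> 'a) topology" where
  "full_shift A = product_topology (\<lambda>_. discrete_topology A) UNIV"

definition shift :: "'g::group_add \<Rightarrow> ('g \<Rightarrow> 'a) \<Rightarrow> 'g \<Rightarrow> 'a" where
  "shift g x = (\<lambda>h. x (h + g))"

definition subshift :: "'a set \<Rightarrow> ('g::group_add \<Rightarrow> 'a) set \<Rightarrow> bool" where
  "subshift A X \<longleftrightarrow> finite A \<and> closedin (full_shift A) X \<and> (\<forall>g. \<forall>x\<in>X. shift g x \<in> X)"

text \<open>
  A pattern \<open>p : F \<rightarrow> A\<close> on a finite \<open>F\<close> is a partial map with domain \<open>F\<close>.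
  The domain may be empty, and the empty pattern occurs in every configuration.
\<close>

definition pattern :: "'a set \<Rightarrow> ('g \<rightharpoonup> 'a) \<Rightarrow> bool" where
  "pattern A p \<longleftrightarrow> finite (dom p) \<and> ran p \<subseteq> A"

definition restr :: "('g \<Rightarrow> 'a) \<Rightarrow> 'g set \<Rightarrow> ('g \<rightharpoonup> 'a)" where
  "restr x F = (Some \<circ> x) |` F"

definition occurs :: "('g::group_add \<rightharpoonup> 'a) \<Rightarrow> ('g \<Rightarrow> 'a) \<Rightarrow> bool" where
  "occurs p x \<longleftrightarrow> (\<exists>g. restr (shift g x) (dom p) = p)"

definition sft :: "'a set \<Rightarrow> ('g::group_add \<Rightarrow> 'a) set \<Rightarrow> bool" where
  "sft A X \<longleftrightarrow> finite A \<and>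
     (\<exists>P. finite P \<and> (\<forall>p\<in>P. pattern A p) \<and>
          X = {x \<in> topspace (full_shift A). \<forall>p\<in>P. \<not> occurs p x})"

definition factor_map ::
  "'a set \<Rightarrow> ('g::group_add \<Rightarrow> 'a) set \<Rightarrow> 'b set \<Rightarrow> ('g \<Rightarrow> 'b) set \<Rightarrow>
   (('g \<Rightarrow> 'a) \<Rightarrow> ('g \<Rightarrow> 'b)) \<Rightarrow> bool" where
  "factor_map A X B W \<phi> \<longleftrightarrow>
     subshift A X \<and> subshift B W \<and>
     continuous_map (subtopology (full_shift A) X) (subtopology (full_shift B) W) \<phi> \<and>
     \<phi> ` X = W \<and>
     (\<forall>g. \<forall>x\<in>X. \<phi> (shift g x) = shift g (\<phi> x))"

definition sofic :: "'b set \<Rightarrow> ('g::group_add \<Rightarrow> 'b) set \<Rightarrow> bool" where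
  "sofic B W \<longleftrightarrow> subshift B W \<and>
     (\<exists>(A :: nat set) X \<phi>. sft A X \<and> factor_map A X B W \<phi>)"

definition one_block_code ::
  "'a set \<Rightarrow> ('g::group_add \<Rightarrow> 'a) set \<Rightarrow> 'b set \<Rightarrow> ('g \<Rightarrow> 'b) set \<Rightarrow>
   (('g \<Rightarrow> 'a) \<Rightarrow> ('g \<Rightarrow> 'b)) \<Rightarrow> bool" where
  "one_block_code A X B W \<phi> \<longleftrightarrow>
     factor_map A X B W \<phi> \<and> (\<exists>\<Phi> \<in> A \<rightarrow> B. \<forall>x\<in>X. \<forall>g. \<phi> x g = \<Phi> (x g))"

definition patterns :: "'g set \<Rightarrow> ('g::group_add \<Rightarrow> 'a) set \<Rightarrow> ('g \<rightharpoonup> 'a) set" where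
  "patterns F X = {restr (shift g x) F | x g. x \<in> X}"

text \<open>
  For a nonempty subshift over an amenable group, the limit along a Folner sequence exists and is
  the same for all Folner sequences; the entropy is this common value.
\<close>

definition entropy :: "('g::group_add \<Rightarrow> 'a) set \<Rightarrow> real" where
  "entropy X = (if X = {} then 0 else
     (THE h. \<forall>F. folner_sequence F \<longrightarrow>
        (\<lambda>n. ln (real (card (patterns (F n) X))) / real (card (F n))) \<longlonglongrightarrow> h))"

definition max_entropy_gap ::
  "'a set \<Rightarrow> ('g::group_add \<Rightarrow> 'a) set \<Rightarrow> (('g \<Rightarrow> 'a) \<Rightarrow> ('g \<Rightarrow> 'b)) \<Rightarrow> ereal" where
  "max_entropy_gap A X \<phi> =
     (SUP X' \<in> {X'. subshift A X' \<and> X' \<subseteq> X}. ereal (entropy X' - entropy (\<phi> ` X')))"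

end

theory Submission
  imports Defs "HOL-Library.Set_Algebras"
begin

text \<open>
  Write the sofic shift \<open>W\<close> as the image of a shift of finite type \<open>X\<close> under a block map \<open>\<Phi>\<close>
  with a finite window. A large gap can only come from a large number of \<open>X\<close>-patterns over a given
  \<open>W\<close>-pattern. The remedy is to add to \<open>X\<close> a layer of low entropy that cuts the group into finite
  cells of small boundary, and to keep, among all fillings of a cell with the same values near its
  boundary and the same image under \<open>\<Phi>\<close>, only one: the canonical filling. Every point of \<open>W\<close> keeps a
  preimage, because the cells are disjoint and can be refilled independently. Over a given image, a
  configuration is now determined by the extra layer and by the few symbols that lie near the
  boundary of a cell or in no cell, so the gap is small.

  The cells do not come from a tiling of the group. The extra layer only marks the centres \<open>c\<close> of some
  translates \<open>F + c\<close> of one almost invariant finite set \<open>F\<close>, and gives each of them one of boundedly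
  many colours; the cell of \<open>c\<close> is the part of \<open>F + c\<close> outside the tiles of smaller colour. Colours
  are used up one after another: each colour receives a maximal family of disjoint translates that
  still contain at least \<open>\<eta> |F|\<close> uncovered points. When this stops, every translate of \<open>F\<close> has fewer
  than \<open>\<eta> |F|\<close> uncovered points (\<open>coloured_cover_exists\<close>). The cells are disjoint and have at least
  \<open>\<eta> |F|\<close> points, so the centres have density at most \<open>1 / (\<eta> |F|)\<close>. Therefore all the boundaries
  together have density at most a constant times \<open>|boundary of F| / (\<eta> |F|)\<close>, which is small once \<open>F\<close>
  is chosen after \<open>\<eta>\<close>, however much the tiles overlap (\<open>card_non_core_points_le\<close>); and the extra
  layer has low entropy (\<open>card_sparse_restr_le\<close>). All conditions on the layer and on the fillings are
  local, so that the new system is again of finite type.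

  The entropy is defined as the common limit along all Folner sequences. That this limit exists
  follows from Shearer's inequality (\<open>Shearer_restr\<close>), which shows that it is the infimum of
  \<open>ln |P(K)| / |K|\<close> over all nonempty finite sets \<open>K\<close>, where \<open>P(K)\<close> is the set of patterns on \<open>K\<close>.
\<close>

section \<open>Pattern counts and the existence of entropy\<close>

lemma dom_restr [simp]: "dom (restr x V) = V"
  by (auto simp: restr_def dom_def restrict_map_def split: if_splits)

lemma restr_eq_iff: "restr x V = restr y V \<longleftrightarrow> (\<forall>v\<in>V. x v = y v)"
  by (auto simp: restr_def restrict_map_def fun_eq_iff)

lemma finite_restr_image:
  assumes "finite A" "finite V" "\<And>x. x \<in> S \<Longrightarrow> range x \<subseteq> A"
  shows "finite ((\<lambda>x. restr x V) ` S)"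
proof (rule finite_subset)
  show "(\<lambda>x. restr x V) ` S \<subseteq> {m. dom m = V \<and> ran m \<subseteq> A}"
    using assms(3) by (fastforce simp: restr_def ran_def restrict_map_def dom_def split: if_splits)
  show "finite {m. dom m = V \<and> ran m \<subseteq> A}"
    using assms(1,2) by (rule finite_set_of_finite_maps[rotated])
qed

lemma card_image_le_if_determines:
  assumes "finite (g ` S)" "\<And>x y. x \<in> S \<Longrightarrow> y \<in> S \<Longrightarrow> g x = g y \<Longrightarrow> f x = f y"
  shows "card (f ` S) \<le> card (g ` S)"
proof -
  have "f x = (\<lambda>u. f (SOME y. y \<in> S \<and> g y = u)) (g x)" if "x \<in> S" for x
    using someI[of "\<lambda>y. y \<in> S \<and> g y = g x" x] that assms(2)[of "SOME y. y \<in> S \<and> g y = g x" x] by auto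
  then have "f ` S \<subseteq> (\<lambda>u. f (SOME y. y \<in> S \<and> g y = u)) ` (g ` S)" by blast
  then show ?thesis using assms(1) by (meson card_image_le card_mono finite_imageI le_trans)
qed

lemma root_prod_le_mean:
  fixes x :: "'i \<Rightarrow> real"
  assumes I: "finite I" "card I = k" "k > 0" and x: "\<And>i. i \<in> I \<Longrightarrow> x i \<ge> 0"
  shows "root k (\<Prod>i\<in>I. x i) \<le> (\<Sum>i\<in>I. x i) / k"
proof (cases "\<exists>i\<in>I. x i = 0")
  case True
  then have "(\<Prod>i\<in>I. x i) = 0" using I by (intro prod_zero) auto
  then show ?thesis using x by (simp add: sum_nonneg)
next
  case False
  then have pos: "x i > 0" if "i \<in> I" for i using x[OF that] that by force
  define r where "r = root k (\<Prod>i\<in>I. x i)"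
  have "(\<Prod>i\<in>I. x i) > 0" using pos by (rule prod_pos)
  then have r: "r > 0" "r ^ k = (\<Prod>i\<in>I. x i)"
    unfolding r_def using I by (simp_all add: real_root_pow_pos)
  have "(\<Prod>i\<in>I. x i) / r ^ k = (\<Prod>i\<in>I. x i / r)"
    using I by (simp add: prod_dividef)
  also have "ln \<dots> = (\<Sum>i\<in>I. ln (x i / r))"
    using I(1) pos r(1) by (intro ln_prod) (auto dest!: pos)
  finally have "real k + ln ((\<Prod>i\<in>I. x i) / r ^ k) = (\<Sum>i\<in>I. 1 + ln (x i / r))"
    using I by (simp add: sum.distrib)
  also have "\<dots> \<le> (\<Sum>i\<in>I. x i / r)"
  proof (rule sum_mono)
    fix i assume "i \<in> I"
    then show "1 + ln (x i / r) \<le> x i / r"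
      using pos r(1) ln_le_minus_one[of "x i / r"] by simp
  qed
  also have "\<dots> = (\<Sum>i\<in>I. x i) / r" by (simp add: sum_divide_distrib)
  finally have "real k \<le> (\<Sum>i\<in>I. x i) / r" using r by (simp split: if_splits)
  then show ?thesis using r(1) I by (simp add: r_def[symmetric] field_simps)
qed

text \<open>
  This is Hoelder's inequality for \<open>k\<close> factors with all exponents equal to \<open>k\<close>. After dividing each
  factor by its sum it follows termwise from the inequality of arithmetic and geometric means.
\<close>

lemma sum_prod_root_le_prod_root_sum:
  fixes f :: "'i \<Rightarrow> 'b \<Rightarrow> real"
  assumes I: "finite I" "card I = k" "k > 0" and B: "finite B" and f: "\<And>i b. f i b \<ge> 0"
  shows "(\<Sum>b\<in>B. \<Prod>i\<in>I. root k (f i b)) \<le> (\<Prod>i\<in>I. root k (\<Sum>b\<in>B. f i b))"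
proof (cases "\<exists>i\<in>I. (\<Sum>b\<in>B. f i b) = 0")
  case True
  then obtain i where i: "i \<in> I" "(\<Sum>b\<in>B. f i b) = 0" by blast
  then have "\<forall>b\<in>B. f i b = 0" using B f by (simp add: sum_nonneg_eq_0_iff)
  then have "(\<Sum>b\<in>B. \<Prod>i\<in>I. root k (f i b)) = 0"
    using i I by (intro sum.neutral ballI prod_zero) auto
  moreover have "0 \<le> (\<Prod>i\<in>I. root k (\<Sum>b\<in>B. f i b))"
    by (intro prod_nonneg real_root_ge_zero sum_nonneg f)
  ultimately show ?thesis by simp
next
  case False
  define s where "s i = (\<Sum>b\<in>B. f i b)" for i
  have s: "s i > 0" if "i \<in> I" for i
    using False that f by (smt (verit) s_def sum_nonneg)
  have P: "(\<Prod>i\<in>I. root k (s i)) > 0" using s I by (intro prod_pos) auto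
  have "(\<Sum>b\<in>B. \<Prod>i\<in>I. root k (f i b)) / (\<Prod>i\<in>I. root k (s i))
      = (\<Sum>b\<in>B. \<Prod>i\<in>I. root k (f i b / s i))"
    by (simp add: sum_divide_distrib prod_dividef real_root_divide)
  also have "\<dots> \<le> (\<Sum>b\<in>B. (\<Sum>i\<in>I. f i b / s i) / k)"
  proof (rule sum_mono)
    fix b assume "b \<in> B"
    have "root k (\<Prod>i\<in>I. f i b / s i) \<le> (\<Sum>i\<in>I. f i b / s i) / k"
      using I by (intro root_prod_le_mean) (auto intro!: divide_nonneg_pos f s)
    moreover have "(\<Prod>i\<in>I. root k (f i b / s i)) = root k (\<Prod>i\<in>I. f i b / s i)"
      using I(1,3) by (induction I) (auto simp: real_root_mult real_root_divide)
    ultimately show "(\<Prod>i\<in>I. root k (f i b / s i)) \<le> (\<Sum>i\<in>I. f i b / s i) / k"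
      using I by simp
  qed
  also have "\<dots> = (\<Sum>i\<in>I. s i / s i) / k"
    unfolding s_def sum_divide_distrib by (subst sum.swap) simp
  also have "\<dots> = 1"
  proof -
    have "(\<Sum>i\<in>I. s i / s i) = (\<Sum>i\<in>I. 1)" by (intro sum.cong) (use s in force)+
    then show ?thesis using I by simp
  qed
  finally show ?thesis using P by (simp add: s_def)
qed

text \<open>
  Shearer's inequality for the number of restrictions. In the induction step, \<open>S\<close> is split according
  to the value at the new point \<open>v\<close>. For the \<open>k\<close> sets \<open>T i\<close> that contain \<open>v\<close>, the number of
  restrictions is the sum over the slices, so that Hoelder's inequality applies; for the other sets,
  the count on a slice is bounded by the count on \<open>S\<close>.
\<close>

lemma Shearer_restr:
  fixes S :: "('g \<Rightarrow> 'a) set" and T :: "'i \<Rightarrow> 'g set"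
  assumes A: "finite A" and "\<And>x. x \<in> S \<Longrightarrow> range x \<subseteq> A"
    and I: "finite I" "k > 0" and T: "\<And>i. i \<in> I \<Longrightarrow> finite (T i)" and "finite V"
    and "\<And>v. v \<in> V \<Longrightarrow> card {i \<in> I. v \<in> T i} = k"
  shows "real (card ((\<lambda>x. restr x V) ` S)) \<le> (\<Prod>i\<in>I. root k (real (card ((\<lambda>x. restr x (T i)) ` S))))"
  using \<open>finite V\<close> assms(2,7)
proof (induction V arbitrary: S)
  case empty
  define p where "p = (\<Prod>i\<in>I. root k (real (card ((\<lambda>x. restr x (T i)) ` S))))"
  show ?case
  proof (cases "S = {}")
    case False
    have "1 \<le> p" unfolding p_def
    proof (rule prod_ge_1)
      fix i assume "i \<in> I"
      have "finite ((\<lambda>x. restr x (T i)) ` S)"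
        using A T[OF \<open>i \<in> I\<close>] empty.prems(1) by (rule finite_restr_image)
      then have "card ((\<lambda>x. restr x (T i)) ` S) \<noteq> 0" using False by simp
      then show "1 \<le> root k (real (card ((\<lambda>x. restr x (T i)) ` S)))"
        using I by simp
    qed
    moreover have "(\<lambda>x. restr x {}) ` S = {Map.empty}"
      using False by (auto simp: restr_def)
    ultimately show ?thesis by (simp add: p_def)
  qed (simp add: prod_nonneg)
next
  case (insert v V)
  define N where "N U S' = real (card ((\<lambda>x. restr x U) ` S'))" for U and S' :: "('g \<Rightarrow> 'a) set"
  define S' where "S' b = {x \<in> S. x v = b}" for b
  define B where "B = (\<lambda>x. x v) ` S"
  have finB: "finite B"
    using insert.prems(1) by (intro finite_subset[OF _ A]) (auto simp: B_def)
  have fin: "finite ((\<lambda>x. restr x U) ` S)" if "finite U" for U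
    using A that insert.prems(1) by (rule finite_restr_image)
  have fin': "finite ((\<lambda>x. restr x U) ` S' b)" if "finite U" for U b
    by (rule finite_subset[OF _ fin[OF that]]) (auto simp: S'_def)
  have split: "N U S = (\<Sum>b\<in>B. N U (S' b))" if "v \<in> U" "finite U" for U
  proof -
    have "(\<lambda>x. restr x U) ` S = (\<Union>b\<in>B. (\<lambda>x. restr x U) ` S' b)"
      by (auto simp: B_def S'_def)
    moreover have "(\<lambda>x. restr x U) ` S' b \<inter> (\<lambda>x. restr x U) ` S' c = {}" if "b \<noteq> c" for b c
      using that \<open>v \<in> U\<close> by (auto simp: S'_def restr_eq_iff)
    ultimately show ?thesis
      unfolding N_def using finB fin'[OF that(2)] by (simp add: card_UN_disjoint)
  qed
  have forget: "N (insert v V) (S' b) \<le> N V (S' b)" for b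
    unfolding N_def of_nat_le_iff
    using fin'[OF insert.hyps(1)] 
    by (rule card_image_le_if_determines) (auto simp: restr_eq_iff S'_def)
  have mono: "N U (S' b) \<le> N U S" if "finite U" for U b
    unfolding N_def of_nat_le_iff
    using fin[OF that] by (rule card_mono) (auto simp: S'_def)
  define I1 where "I1 = {i \<in> I. v \<in> T i}"
  define I0 where "I0 = {i \<in> I. v \<notin> T i}"
  have split_I: "(\<Prod>i\<in>I. h i) = (\<Prod>i\<in>I1. h i) * (\<Prod>i\<in>I0. h i)" for h :: "'i \<Rightarrow> real"
  proof -
    have "I = I1 \<union> I0" "I1 \<inter> I0 = {}" "finite I1" "finite I0"
      using I by (auto simp: I1_def I0_def)
    then show ?thesis by (simp add: prod.union_disjoint)
  qed
  have "N (insert v V) S = (\<Sum>b\<in>B. N (insert v V) (S' b))"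
    using insert.hyps by (intro split) auto
  also have "\<dots> \<le> (\<Sum>b\<in>B. N V (S' b))"
    by (intro sum_mono forget)
  also have "\<dots> \<le> (\<Sum>b\<in>B. \<Prod>i\<in>I. root k (N (T i) (S' b)))"
    unfolding N_def using insert.prems by (intro sum_mono insert.IH) (auto simp: S'_def)
  also have "\<dots> = (\<Sum>b\<in>B. (\<Prod>i\<in>I1. root k (N (T i) (S' b))) * (\<Prod>i\<in>I0. root k (N (T i) (S' b))))"
    by (simp add: split_I)
  also have "\<dots> \<le> (\<Sum>b\<in>B. (\<Prod>i\<in>I1. root k (N (T i) (S' b))) * (\<Prod>i\<in>I0. root k (N (T i) S)))"
    using I mono T by (intro sum_mono mult_left_mono prod_mono conjI prod_nonneg)
      (auto simp: N_def I0_def)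
  also have "\<dots> = (\<Sum>b\<in>B. \<Prod>i\<in>I1. root k (N (T i) (S' b))) * (\<Prod>i\<in>I0. root k (N (T i) S))"
    by (simp add: sum_distrib_right)
  also have "\<dots> \<le> (\<Prod>i\<in>I1. root k (\<Sum>b\<in>B. N (T i) (S' b))) * (\<Prod>i\<in>I0. root k (N (T i) S))"
    using I insert.prems(2)[of v] finB
    by (intro mult_right_mono sum_prod_root_le_prod_root_sum prod_nonneg) (auto simp: I1_def N_def)
  also have "\<dots> = (\<Prod>i\<in>I1. root k (N (T i) S)) * (\<Prod>i\<in>I0. root k (N (T i) S))"
    using split T by (intro arg_cong2[of _ _ _ _ "(*)"] prod.cong refl) (auto simp: I1_def)
  also have "\<dots> = (\<Prod>i\<in>I. root k (N (T i) S))"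
    by (simp add: split_I)
  finally show ?case by (simp add: N_def)
qed

lemma shift_shift [simp]: "shift g (shift h x) = shift (g + h) x"
  by (simp add: shift_def add.assoc)

lemma shift_zero [simp]: "shift 0 x = x"
  by (simp add: shift_def)

lemma finite_patterns:
  assumes "finite A" "finite V" "\<And>x. x \<in> X \<Longrightarrow> range x \<subseteq> A"
  shows "finite (patterns V X)"
proof -
  have "patterns V X = (\<lambda>x. restr x V) ` {shift g x | x g. x \<in> X}"
    by (auto simp: patterns_def)
  then show ?thesis
    using finite_restr_image[OF assms(1,2), of "{shift g x | x g. x \<in> X}"] assms(3)
    by (force simp: shift_def)
qed

lemma set_plus_uminus_iff:
  fixes K :: "'g::group_add set"
  shows "g \<in> uminus ` K + V \<longleftrightarrow> (\<exists>k\<in>K. k + g \<in> V)"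
proof
  assume "g \<in> uminus ` K + V"
  then obtain k v where "k \<in> K" "v \<in> V" "g = - k + v" by (auto simp: set_plus_def)
  then have "k + g \<in> V" by (simp add: add.assoc[symmetric])
  then show "\<exists>k\<in>K. k + g \<in> V" using \<open>k \<in> K\<close> by blast
next
  assume "\<exists>k\<in>K. k + g \<in> V"
  then obtain k where "k \<in> K" "k + g \<in> V" by blast
  moreover have "g = - k + (k + g)" by (simp add: add.assoc[symmetric])
  ultimately show "g \<in> uminus ` K + V" by (metis imageI set_plus_intro)
qed

text \<open>
  Shearer's inequality for the right translates of \<open>K\<close> that meet \<open>V\<close>: each point of \<open>V\<close> lies in
  exactly \<open>card K\<close> of them, and all translates carry equally many patterns.
\<close>

lemma ln_card_patterns_le:
  fixes X :: "('g::group_add \<Rightarrow> 'a) set"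
  assumes A: "finite A" "\<And>x. x \<in> X \<Longrightarrow> range x \<subseteq> A" and "X \<noteq> {}"
    and K: "finite K" "K \<noteq> {}" and V: "finite V"
  shows "ln (real (card (patterns V X)))
    \<le> real (card (uminus ` K + V)) * (ln (real (card (patterns K X))) / real (card K))"
proof -
  define S where "S = {shift g x | x g. x \<in> X}"
  have pat: "patterns U X = (\<lambda>x. restr x U) ` S" for U
    by (auto simp: patterns_def S_def)
  have S: "range x \<subseteq> A" if "x \<in> S" for x
    using that A(2) by (force simp: S_def shift_def)
  define I where "I = uminus ` K + V"
  define k where "k = card K"
  have I: "finite I" using K V by (auto simp: I_def intro: finite_set_plus)
  have k: "k > 0" using K by (simp add: k_def card_gt_0_iff)
  define N where "N U = real (card ((\<lambda>x. restr x U) ` S))" for U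
  have N1: "N U \<ge> 1" if "finite U" for U
  proof -
    have "finite ((\<lambda>x. restr x U) ` S)" using A(1) that S by (rule finite_restr_image)
    moreover have "S \<noteq> {}" using \<open>X \<noteq> {}\<close> by (auto simp: S_def)
    ultimately have "card ((\<lambda>x. restr x U) ` S) \<noteq> 0" by simp
    then show ?thesis by (simp add: N_def)
  qed
  have trans: "N ((\<lambda>h. h + g) ` K) \<le> N K" for g
  proof -
    have fin: "finite ((\<lambda>x. restr x K) ` S)" using A(1) K(1) S by (rule finite_restr_image)
    have shS: "shift g x \<in> S" if "x \<in> S" for x
    proof -
      obtain y h where "x = shift h y" "y \<in> X" using \<open>x \<in> S\<close> unfolding S_def by blast
      then have "shift g x = shift (g + h) y" by simp
      then show ?thesis using \<open>y \<in> X\<close> unfolding S_def by blast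
    qed
    then have sub: "(\<lambda>x. restr (shift g x) K) ` S \<subseteq> (\<lambda>x. restr x K) ` S" by blast
    have "card ((\<lambda>x. restr x ((\<lambda>h. h + g) ` K)) ` S) \<le> card ((\<lambda>x. restr (shift g x) K) ` S)"
      using finite_subset[OF sub fin]
      by (rule card_image_le_if_determines) (auto simp: restr_eq_iff shift_def)
    also have "\<dots> \<le> card ((\<lambda>x. restr x K) ` S)"
      using fin sub by (rule card_mono)
    finally show ?thesis by (simp add: N_def)
  qed
  have "N V \<le> (\<Prod>g\<in>I. root k (N ((\<lambda>h. h + g) ` K)))"
    unfolding N_def
  proof (rule Shearer_restr[OF A(1) S I k _ V])
    fix v assume v: "v \<in> V"
    have "{g \<in> I. v \<in> (\<lambda>h. h + g) ` K} = (\<lambda>h. - h + v) ` K"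
    proof (rule set_eqI)
      fix g
      have "v = h + g \<longleftrightarrow> g = - h + v" for h by (auto simp: add.assoc[symmetric])
      then show "g \<in> {g \<in> I. v \<in> (\<lambda>h. h + g) ` K} \<longleftrightarrow> g \<in> (\<lambda>h. - h + v) ` K"
        using v by (auto simp: I_def set_plus_def)
    qed
    also have "card \<dots> = k" unfolding k_def by (intro card_image inj_onI) simp
    finally show "card {g \<in> I. v \<in> (\<lambda>h. h + g) ` K} = k" .
  qed (use K in auto)
  also have "\<dots> \<le> (\<Prod>g\<in>I. root k (N K))"
    using k trans by (intro prod_mono) (auto simp: N_def)
  finally have "N V \<le> root k (N K) ^ card I" by simp
  then have "ln (N V) \<le> ln (root k (N K) ^ card I)"
    using N1[OF V] by simp
  also have "\<dots> = card I * (ln (N K) / k)"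
    using N1[OF K(1)] k by (simp add: ln_realpow ln_root)
  finally show ?thesis by (simp add: pat N_def I_def k_def)
qed

lemma folner_sequenceD:
  fixes F :: "nat \<Rightarrow> 'g::group_add set"
  assumes "folner_sequence F"
  shows "finite (F n)" "eventually (\<lambda>n. g \<in> F n) sequentially" "eventually (\<lambda>n. card (F n) > 0) sequentially"
proof -
  show fin: "finite (F n)" for n using assms by (simp add: folner_sequence_def)
  show ev: "eventually (\<lambda>n. g \<in> F n) sequentially" for g using assms by (simp add: folner_sequence_def)
  show "eventually (\<lambda>n. card (F n) > 0) sequentially"
    using ev[of 0] by eventually_elim (use fin in \<open>auto simp: card_gt_0_iff\<close>)
qed

lemma folner_set_plus_diff:
  assumes F: "folner_sequence F" and K: "finite K" "K \<noteq> {}"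
  shows "(\<lambda>n. real (card ((K + F n) - F n)) / real (card (F n))) \<longlonglongrightarrow> 0"
proof (rule tendsto_sandwich[OF _ _ tendsto_const])
  have eq: "{k + f | k f. k \<in> K \<and> f \<in> F n} = K + F n" for n by (auto simp: set_plus_def)
  show "(\<lambda>n. real (card (((K + F n) - F n) \<union> (F n - (K + F n)))) / real (card (F n))) \<longlonglongrightarrow> 0"
    using conjunct2[OF conjunct2[OF F[unfolded folner_sequence_def Let_def]], rule_format, OF conjI[OF K]]
    unfolding eq .
  show "\<forall>\<^sub>F n in sequentially. real (card ((K + F n) - F n)) / real (card (F n))
      \<le> real (card (((K + F n) - F n) \<union> (F n - (K + F n)))) / real (card (F n))"
    using K folner_sequenceD(1)[OF F]
    by (intro always_eventually allI divide_right_mono of_nat_mono card_mono) (auto intro: finite_set_plus)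
qed auto

lemma card_le_set_plus:
  fixes K :: "'g::group_add set"
  assumes "finite K" "K \<noteq> {}" "finite V"
  shows "card V \<le> card (K + V)"
proof -
  obtain k where "k \<in> K" using assms by blast
  then have "card ((\<lambda>v. k + v) ` V) \<le> card (K + V)"
    using assms by (intro card_mono finite_set_plus) auto
  then show ?thesis by (simp add: card_image)
qed

text \<open>
  Enlarging the sets of a Folner sequence by a fixed finite set does not change densities. All error
  terms below are ratios of this kind.
\<close>

lemma folner_set_plus_ratio:
  assumes F: "folner_sequence F" and K: "finite K" "K \<noteq> {}"
  shows "(\<lambda>n. real (card (K + F n)) / real (card (F n))) \<longlonglongrightarrow> 1"
proof (rule tendsto_sandwich[OF _ _ tendsto_const])
  show "(\<lambda>n. 1 + real (card ((K + F n) - F n)) / real (card (F n))) \<longlonglongrightarrow> 1"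
    using tendsto_add[OF tendsto_const folner_set_plus_diff[OF assms], of 1] by simp
  show "\<forall>\<^sub>F n in sequentially. 1 \<le> real (card (K + F n)) / real (card (F n))"
    using folner_sequenceD(3)[OF F]
    by eventually_elim (use card_le_set_plus[OF K folner_sequenceD(1)[OF F]] in simp)
  show "\<forall>\<^sub>F n in sequentially. real (card (K + F n)) / real (card (F n))
      \<le> 1 + real (card ((K + F n) - F n)) / real (card (F n))"
    using folner_sequenceD(3)[OF F]
  proof eventually_elim
    case (elim n)
    have "card (K + F n) \<le> card (F n \<union> ((K + F n) - F n))"
      using K folner_sequenceD(1)[OF F] by (intro card_mono) (auto intro: finite_set_plus)
    also have "\<dots> \<le> card (F n) + card ((K + F n) - F n)" by (rule card_Un_le)
    finally show ?case using elim by (simp add: field_simps flip: of_nat_add)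
  qed
qed

text \<open>
  By \<open>ln_card_patterns_le\<close>, the normalised pattern count on \<open>F n\<close> is at most that on any fixed \<open>K\<close>, up
  to a factor tending to 1. Hence it converges to the infimum over all \<open>K\<close>, which does not refer to
  the sequence, so that the definite description defining the entropy is met.
\<close>

lemma entropy_eq_limit:
  fixes X :: "('g::group_add \<Rightarrow> 'a) set"
  assumes A: "finite A" "\<And>x. x \<in> X \<Longrightarrow> range x \<subseteq> A" and "X \<noteq> {}"
    and F: "folner_sequence F"
  shows "(\<lambda>n. ln (real (card (patterns (F n) X))) / real (card (F n))) \<longlonglongrightarrow> entropy X"
proof -
  define a where "a K = ln (real (card (patterns K X))) / real (card K)" for K
  define Ks :: "'g set set" where "Ks = {K. finite K \<and> K \<noteq> {}}"
  define h where "h = Inf (a ` Ks)"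
  have pos: "a K \<ge> 0" if "finite K" for K
  proof -
    have "finite (patterns K X)" using A(1) that A(2) by (rule finite_patterns)
    moreover have "patterns K X \<noteq> {}" using \<open>X \<noteq> {}\<close> by (auto simp: patterns_def)
    ultimately have "card (patterns K X) \<noteq> 0" by simp
    then show ?thesis by (simp add: a_def)
  qed
  have bdd: "bdd_below (a ` Ks)" using pos by (auto simp: Ks_def intro!: bdd_belowI)
  have lim: "(\<lambda>n. a (F n)) \<longlonglongrightarrow> h" if F: "folner_sequence F" for F
  proof (rule order_tendstoI)
    fix y assume "y < h"
    show "\<forall>\<^sub>F n in sequentially. y < a (F n)"
      using folner_sequenceD(3)[OF F]
    proof eventually_elim
      case (elim n)
      then have "F n \<in> Ks" by (auto simp: Ks_def card_gt_0_iff)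
      then have "h \<le> a (F n)" unfolding h_def using bdd by (intro cInf_lower) auto
      then show ?case using \<open>y < h\<close> by simp
    qed
  next
    fix y assume "h < y"
    moreover have "{0} \<in> Ks" by (simp add: Ks_def)
    ultimately obtain K where K: "K \<in> Ks" "a K < y"
      unfolding h_def using bdd cInf_less_iff[of "a ` Ks" y] by auto
    then have K': "finite K" "K \<noteq> {}" by (auto simp: Ks_def)
    have "(\<lambda>n. real (card (uminus ` K + F n)) / real (card (F n)) * a K) \<longlonglongrightarrow> 1 * a K"
      using F K' by (intro tendsto_mult folner_set_plus_ratio tendsto_const) auto
    then have "\<forall>\<^sub>F n in sequentially. real (card (uminus ` K + F n)) / real (card (F n)) * a K < y"
      using K(2) by (intro order_tendstoD(2)) auto
    then show "\<forall>\<^sub>F n in sequentially. a (F n) < y"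
      using folner_sequenceD(3)[OF F]
    proof eventually_elim
      case (elim n)
      have "ln (real (card (patterns (F n) X))) \<le> real (card (uminus ` K + F n)) * a K"
        unfolding a_def using ln_card_patterns_le[OF A \<open>X \<noteq> {}\<close> K' folner_sequenceD(1)[OF F]] .
      then have "a (F n) \<le> real (card (uminus ` K + F n)) * a K / real (card (F n))"
        unfolding a_def[of "F n"] using elim(2) by (intro divide_right_mono) auto
      then have "a (F n) \<le> real (card (uminus ` K + F n)) / real (card (F n)) * a K"
        by simp
      then show ?case using elim(1) by simp
    qed
  qed
  have "entropy X = h"
  proof -
    have "(THE h. \<forall>F :: nat \<Rightarrow> 'g set. folner_sequence F \<longrightarrow> (\<lambda>n. a (F n)) \<longlonglongrightarrow> h) = h"
      using lim F by (intro the_equality) (auto intro: LIMSEQ_unique)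
    then show ?thesis using \<open>X \<noteq> {}\<close> by (simp add: entropy_def a_def)
  qed
  then show ?thesis using lim[OF F] by (simp add: a_def)
qed

section \<open>Finite windows\<close>

definition depends_on :: "'g set \<Rightarrow> (('g \<Rightarrow> 'a) \<Rightarrow> 'b) \<Rightarrow> bool" where
  "depends_on M Q \<longleftrightarrow> (\<forall>x y. (\<forall>m\<in>M. x m = y m) \<longrightarrow> Q x = Q y)"

lemma depends_onD: "depends_on M Q \<Longrightarrow> (\<And>m. m \<in> M \<Longrightarrow> x m = y m) \<Longrightarrow> Q x = Q y"
  by (simp add: depends_on_def)

lemma topspace_full_shift: "topspace (full_shift A) = {x. range x \<subseteq> A}"
  by (auto simp: full_shift_def PiE_UNIV_domain)

lemma sft_local_rule:
  fixes Q :: "('g::group_add \<Rightarrow> 'a) \<Rightarrow> bool"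
  assumes A: "finite A" and M: "finite M" and Q: "depends_on M Q"
  shows "sft A {x. range x \<subseteq> A \<and> (\<forall>g. Q (shift g x))}"
  unfolding sft_def
proof (intro conjI A)
  define P where "P = (\<lambda>x. restr x M) ` {x. range x \<subseteq> A \<and> \<not> Q x}"
  have dom: "dom p = M" if "p \<in> P" for p using that unfolding P_def by (elim imageE) simp
  have "{x. range x \<subseteq> A \<and> (\<forall>g. Q (shift g x))} = {x \<in> topspace (full_shift A). \<forall>p\<in>P. \<not> occurs p x}"
  proof (intro set_eqI iffI; clarsimp simp: topspace_full_shift)
    fix x p assume x: "range x \<subseteq> A" "\<forall>g. Q (shift g x)" and p: "p \<in> P" "occurs p x"
    then obtain g where g: "restr (shift g x) M = p" by (auto simp: occurs_def dom)
    obtain z where z: "\<not> Q z" "p = restr z M" using p by (auto simp: P_def)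
    have "Q (shift g x) = Q z" using g z(2) by (intro depends_onD[OF Q]) (auto simp: restr_eq_iff)
    then show False using x z by simp
  next
    fix x g assume x: "range x \<subseteq> A" "\<forall>p\<in>P. \<not> occurs p x"
    show "Q (shift g x)"
    proof (rule ccontr)
      assume "\<not> Q (shift g x)"
      moreover have "range (shift g x) \<subseteq> A" using x by (auto simp: shift_def)
      ultimately have "restr (shift g x) M \<in> P" by (auto simp: P_def)
      moreover have "occurs (restr (shift g x) M) x" by (auto simp: occurs_def)
      ultimately show False using x by blast
    qed
  qed
  moreover have "finite P" unfolding P_def using A M by (rule finite_restr_image) auto
  moreover have "pattern A p" if "p \<in> P" for p
  proof -
    obtain x where x: "range x \<subseteq> A" "p = restr x M" using \<open>p \<in> P\<close> by (auto simp: P_def)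
    then have "ran p \<subseteq> A" by (auto simp: ran_def restr_def restrict_map_def split: if_splits)
    then show ?thesis using M dom[OF that] by (simp add: pattern_def)
  qed
  ultimately show "\<exists>P. finite P \<and> (\<forall>p\<in>P. pattern A p) \<and>
      {x. range x \<subseteq> A \<and> (\<forall>g. Q (shift g x))} = {x \<in> topspace (full_shift A). \<forall>p\<in>P. \<not> occurs p x}"
    by (intro exI[of _ P] conjI ballI)
qed

lemma sft_obtain_local_rule:
  fixes X :: "('g::group_add \<Rightarrow> 'a) set"
  assumes "sft A X"
  obtains M R where "finite M" "depends_on M R" "X = {x. range x \<subseteq> A \<and> (\<forall>g. R (shift g x))}"
proof -
  obtain P where P: "finite P" "\<And>p. p \<in> P \<Longrightarrow> pattern A p"
      "X = {x \<in> topspace (full_shift A). \<forall>p\<in>P. \<not> occurs p x}"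
    using assms by (auto simp: sft_def)
  define R where "R x \<longleftrightarrow> (\<forall>p\<in>P. restr x (dom p) \<noteq> p)" for x
  show thesis
  proof (rule that)
    show "finite (\<Union>p\<in>P. dom p)" using P by (auto simp: pattern_def)
    show "depends_on (\<Union>p\<in>P. dom p) R"
      unfolding depends_on_def R_def
    proof (intro allI impI ball_cong refl)
      fix x y :: "'g \<Rightarrow> 'a" and p assume *: "\<forall>m\<in>\<Union>p\<in>P. dom p. x m = y m" "p \<in> P"
      then have "restr x (dom p) = restr y (dom p)" unfolding restr_eq_iff by blast
      then show "(restr x (dom p) \<noteq> p) = (restr y (dom p) \<noteq> p)" by simp
    qed
    show "X = {x. range x \<subseteq> A \<and> (\<forall>g. R (shift g x))}"
      unfolding P(3) R_def topspace_full_shift by (auto simp: occurs_def)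
  qed
qed

lemma openin_full_shift_window:
  assumes "finite M" "depends_on M Q"
  shows "openin (full_shift A) {x. range x \<subseteq> A \<and> Q x}"
  unfolding full_shift_def openin_product_topology_alt
proof (intro ballI)
  fix x assume x: "x \<in> {x. range x \<subseteq> A \<and> Q x}"
  define U where "U i = (if i \<in> M then {x i} else A)" for i
  have "finite {i \<in> UNIV. U i \<noteq> topspace (discrete_topology A)}"
    by (rule finite_subset[OF _ assms(1)]) (auto simp: U_def)
  moreover have "PiE UNIV U \<subseteq> {x. range x \<subseteq> A \<and> Q x}"
  proof
    fix y assume "y \<in> PiE UNIV U"
    then have y: "y i \<in> U i" for i by (auto simp: PiE_UNIV_domain)
    have "y i \<in> A" for i using y[of i] x by (auto simp: U_def split: if_splits)
    moreover have "y m = x m" if "m \<in> M" for m using y[of m] that by (simp add: U_def)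
    then have "Q y = Q x" by (rule depends_onD[OF assms(2)])
    ultimately show "y \<in> {x. range x \<subseteq> A \<and> Q x}" using x by auto
  qed
  ultimately show "\<exists>U. finite {i \<in> UNIV. U i \<noteq> topspace (discrete_topology A)} \<and>
      (\<forall>i\<in>UNIV. openin (discrete_topology A) (U i)) \<and> x \<in> PiE UNIV U \<and>
      PiE UNIV U \<subseteq> {x. range x \<subseteq> A \<and> Q x}"
    using x by (intro exI[of _ U]) (auto simp: U_def)
qed

lemma depends_on_shift:
  assumes "depends_on M Q"
  shows "depends_on ((\<lambda>m. m + g) ` M) (\<lambda>x. Q (shift g x))"
  using assms by (auto simp: depends_on_def shift_def)

lemma subshift_local_rule:
  fixes Q :: "('g::group_add \<Rightarrow> 'a) \<Rightarrow> bool"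
  assumes A: "finite A" and M: "finite M" and Q: "depends_on M Q"
  shows "subshift A {x. range x \<subseteq> A \<and> (\<forall>g. Q (shift g x))}" (is "subshift A ?X")
  unfolding subshift_def
proof (intro conjI A allI ballI)
  have "openin (full_shift A) {x. range x \<subseteq> A \<and> \<not> Q (shift g x)}" for g
  proof (rule openin_full_shift_window)
    show "depends_on ((\<lambda>m. m + g) ` M) (\<lambda>x. \<not> Q (shift g x))"
      using depends_on_shift[OF Q] by (auto simp: depends_on_def)
  qed (use M in auto)
  then have "openin (full_shift A) (\<Union>g. {x. range x \<subseteq> A \<and> \<not> Q (shift g x)})" by blast
  moreover have "(\<Union>g. {x. range x \<subseteq> A \<and> \<not> Q (shift g x)}) = topspace (full_shift A) - ?X"
    by (auto simp: topspace_full_shift)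
  ultimately show "closedin (full_shift A) ?X"
    by (auto simp: closedin_def topspace_full_shift)
  show "shift g x \<in> ?X" if "x \<in> ?X" for g x
    using that by (force simp: shift_def add.assoc)
qed

lemma subshiftD:
  assumes "subshift A X"
  shows "finite A" "\<And>x. x \<in> X \<Longrightarrow> range x \<subseteq> A" "\<And>g x. x \<in> X \<Longrightarrow> shift g x \<in> X"
    "closedin (full_shift A) X"
  using assms closedin_subset[of "full_shift A" X] by (auto simp: subshift_def topspace_full_shift)

text \<open>
  The theorem of Curtis, Hedlund and Lyndon. By continuity each point has a cylinder on which the
  symbol at 0 of the image is constant, and finitely many of these cylinders cover the compact set
  \<open>X\<close>; the union of their windows works.
\<close>

lemma factor_map_finite_window:
  fixes \<phi> :: "('g::group_add \<Rightarrow> 'a) \<Rightarrow> ('g \<Rightarrow> 'b)"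
  assumes "factor_map A X B W \<phi>"
  obtains M where "finite M" "\<And>x y. x \<in> X \<Longrightarrow> y \<in> X \<Longrightarrow> (\<And>m. m \<in> M \<Longrightarrow> x m = y m) \<Longrightarrow> \<phi> x 0 = \<phi> y 0"
proof -
  have X: "subshift A X" and W: "subshift B W" 
    and cont: "continuous_map (subtopology (full_shift A) X) (subtopology (full_shift B) W) \<phi>"
    and im: "\<phi> ` X = W"
    using assms by (auto simp: factor_map_def)
  have "compact_space (full_shift A)"
    unfolding full_shift_def using subshiftD(1)[OF X]
    by (auto simp: compact_space_product_topology compact_space_discrete_topology)
  then have comp: "compactin (full_shift A) X"
    using subshiftD(4)[OF X] by (rule closedin_compact_space)
  have "\<exists>M. finite M \<and> (\<forall>y\<in>X. (\<forall>m\<in>M. y m = x m) \<longrightarrow> \<phi> y 0 = \<phi> x 0)" if x: "x \<in> X" for x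
  proof -
    define T where "T = {y \<in> X. \<phi> y 0 = \<phi> x 0}"
    have "openin (full_shift B) {w. range w \<subseteq> B \<and> w 0 = \<phi> x 0}"
      by (rule openin_full_shift_window[of "{0}"]) (auto simp: depends_on_def)
    then have "openin (subtopology (full_shift B) W) ({w. range w \<subseteq> B \<and> w 0 = \<phi> x 0} \<inter> W)"
      by (auto simp: openin_subtopology)
    from openin_continuous_map_preimage[OF cont this]
    have "openin (subtopology (full_shift A) X) {y \<in> topspace (subtopology (full_shift A) X).
        \<phi> y \<in> {w. range w \<subseteq> B \<and> w 0 = \<phi> x 0} \<inter> W}" .
    also have "\<dots> = T"
    proof -
      have "topspace (subtopology (full_shift A) X) = X"
        using subshiftD(2)[OF X] unfolding topspace_subtopology topspace_full_shift by blast
      then show ?thesis using im subshiftD(2)[OF W] by (auto simp: T_def)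
    qed
    finally obtain U where U: "openin (full_shift A) U" "T = U \<inter> X"
      by (auto simp: openin_subtopology)
    have "x \<in> U" using x U by (auto simp: T_def)
    then obtain V where V: "finite {i \<in> UNIV. V i \<noteq> topspace (discrete_topology A)}"
        "x \<in> PiE UNIV V" "PiE UNIV V \<subseteq> U"
      using U(1) unfolding full_shift_def openin_product_topology_alt by blast
    show ?thesis
    proof (intro exI conjI ballI impI)
      show "finite {i \<in> UNIV. V i \<noteq> topspace (discrete_topology A)}" by (fact V(1))
      fix y assume y: "y \<in> X" "\<forall>m\<in>{i \<in> UNIV. V i \<noteq> topspace (discrete_topology A)}. y m = x m"
      have "y i \<in> V i" for i
      proof (cases "V i = A")
        case True
        then show ?thesis using subshiftD(2)[OF X y(1)] by auto
      next
        case False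
        then show ?thesis using y(2) V(2) by (auto simp: PiE_UNIV_domain)
      qed
      then have "y \<in> U" using V(3) by (auto simp: PiE_UNIV_domain)
      then show "\<phi> y 0 = \<phi> x 0" using y(1) U(2) by (auto simp: T_def)
    qed
  qed
  then obtain N where N: "\<And>x. x \<in> X \<Longrightarrow> finite (N x)"
      "\<And>x y. x \<in> X \<Longrightarrow> y \<in> X \<Longrightarrow> (\<forall>m\<in>N x. y m = x m) \<Longrightarrow> \<phi> y 0 = \<phi> x 0"
    by metis
  define C where "C x = {y. range y \<subseteq> A \<and> (\<forall>m\<in>N x. y m = x m)}" for x
  have opn: "openin (full_shift A) (C x)" if "x \<in> X" for x
    unfolding C_def by (rule openin_full_shift_window[OF N(1)[OF that]]) (auto simp: depends_on_def)
  have "X \<subseteq> \<Union>(C ` X)" using subshiftD(2)[OF X] by (auto simp: C_def)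
  then obtain \<F> where "finite \<F>" "\<F> \<subseteq> C ` X" "X \<subseteq> \<Union>\<F>"
    using comp opn unfolding compactin_def by (metis (no_types, lifting) imageE)
  then obtain X0 where X0: "finite X0" "X0 \<subseteq> X" "X \<subseteq> \<Union>(C ` X0)"
    by (metis finite_subset_image)
  show thesis
  proof (rule that)
    show "finite (\<Union>x\<in>X0. N x)" using X0 N(1) by auto
    fix x y assume xy: "x \<in> X" "y \<in> X" "\<And>m. m \<in> (\<Union>x\<in>X0. N x) \<Longrightarrow> x m = y m"
    then obtain z where z: "z \<in> X0" "x \<in> C z" using X0 by blast
    then have "\<phi> x 0 = \<phi> z 0" using xy X0 by (intro N(2)) (auto simp: C_def)
    moreover have "\<phi> y 0 = \<phi> z 0"
    proof (rule N(2))
      have "y m = x m" "x m = z m" if "m \<in> N z" for m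
      proof -
        have "m \<in> (\<Union>x\<in>X0. N x)" using z(1) that by blast
        then show "y m = x m" using xy(3) by simp
        show "x m = z m" using z(2) that by (simp add: C_def)
      qed
      then show "\<forall>m\<in>N z. y m = z m" by simp
    qed (use xy X0 z in auto)
    ultimately show "\<phi> x 0 = \<phi> y 0" by simp
  qed
qed

section \<open>Coloured covers by translates of a finite set\<close>

text \<open>
  A function \<open>t\<close> marks \<open>c\<close> as a centre of colour \<open>t c\<close> if \<open>t c > 0\<close>; the value 0 means that \<open>c\<close> is
  no centre. The tile of a centre \<open>c\<close> is \<open>F + {c}\<close>, hence the tiles containing a point \<open>g\<close> are those
  of the centres among the points \<open>- f' + g\<close> with \<open>f' \<in> F\<close>. The shape is the part of the tile of
  the origin outside all tiles of smaller colour. All notions are defined at the origin and moved to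
  other points by \<open>shift\<close>, which makes them invariant under translation.
\<close>

definition shape :: "'g::group_add set \<Rightarrow> ('g \<Rightarrow> nat) \<Rightarrow> 'g set" where
  "shape F t = {f \<in> F. \<forall>f'\<in>F. \<not> (0 < t (- f' + f) \<and> t (- f' + f) < t 0)}"

definition cell :: "'g::group_add set \<Rightarrow> ('g \<Rightarrow> nat) \<Rightarrow> 'g \<Rightarrow> 'g set" where
  "cell F t c = (\<lambda>f. f + c) ` shape F (shift c t)"

definition uncovered :: "'g::group_add set \<Rightarrow> ('g \<Rightarrow> nat) \<Rightarrow> 'g set" where
  "uncovered F t = {f \<in> F. \<forall>f'\<in>F. t (- f' + f) = 0}"

text \<open>
  The middle condition says that tiles of equal colour are disjoint: the tile of \<open>- f' + f\<close> is a tile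
  that meets the one of the origin in the point \<open>f\<close>.
\<close>

definition cover_rule :: "'g::group_add set \<Rightarrow> real \<Rightarrow> ('g \<Rightarrow> nat) \<Rightarrow> bool" where
  "cover_rule F \<eta> t \<longleftrightarrow>
     (0 < t 0 \<longrightarrow> \<eta> * real (card F) \<le> card (shape F t) \<and>
        (\<forall>f\<in>F. \<forall>f'\<in>F. f' \<noteq> f \<longrightarrow> t (- f' + f) \<noteq> t 0)) \<and>
     card (uncovered F t) \<le> \<eta> * real (card F)"

lemma depends_on_cover_rule:
  fixes F :: "'g::group_add set"
  shows "depends_on (uminus ` F + F) (cover_rule F \<eta>)"
  unfolding depends_on_def
proof (intro allI impI)
  fix s t :: "'g \<Rightarrow> nat" assume st: "\<forall>d\<in>uminus ` F + F. s d = t d"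
  have eq: "s (- f' + f) = t (- f' + f)" if "f \<in> F" "f' \<in> F" for f f'
    using st that by (meson imageI set_plus_intro)
  then have u: "uncovered F s = uncovered F t" by (auto simp: uncovered_def)
  show "cover_rule F \<eta> s = cover_rule F \<eta> t"
  proof (cases "F = {}")
    case False
    then have "s 0 = t 0" using eq by (metis ex_in_conv left_minus)
    moreover from this have "shape F s = shape F t" using eq by (auto simp: shape_def)
    ultimately show ?thesis using u eq by (simp add: cover_rule_def)
  qed (simp add: cover_rule_def uncovered_def shape_def)
qed

lemma mem_cell_iff: "g \<in> cell F t c \<longleftrightarrow>
    g - c \<in> F \<and> (\<forall>f'\<in>F. \<not> (0 < t (- f' + g) \<and> t (- f' + g) < t c))"
proof -
  have "g \<in> cell F t c \<longleftrightarrow> g - c \<in> shape F (shift c t)"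
    unfolding cell_def by (auto simp: image_iff) (metis diff_add_cancel)
  then show ?thesis by (simp add: shape_def shift_def add.assoc)
qed

lemma mem_uncovered_shift_iff: "f \<in> uncovered F (shift c t) \<longleftrightarrow> f \<in> F \<and> (\<forall>f'\<in>F. t (- f' + (f + c)) = 0)"
  by (simp add: uncovered_def shift_def add.assoc)

lemma cell_subset: "cell F t c \<subseteq> F + {c}"
  by (auto simp: cell_def shape_def)

lemma card_cell: "card (cell F t c) = card (shape F (shift c t))"
  unfolding cell_def by (intro card_image inj_onI) simp

lemma cells_disjoint:
  fixes t :: "'g::group_add \<Rightarrow> nat"
  assumes rule: "\<And>g. cover_rule F \<eta> (shift g t)" and "0 < t c" "0 < t c'" and "c \<noteq> c'"
  shows "cell F t c \<inter> cell F t c' = {}"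
proof -
  have main: "cell F t c \<inter> cell F t c' = {}" if c: "0 < t c" "t c \<le> t c'" "c \<noteq> c'" for c c'
  proof (rule equals0I)
    fix g assume g: "g \<in> cell F t c \<inter> cell F t c'"
    define f where "f = g - c"
    define f' where "f' = g - c'"
    have F: "f \<in> F" "f' \<in> F" using g by (auto simp: mem_cell_iff f_def f'_def)
    have gf: "g = f + c" "g = f' + c'" by (simp_all add: f_def f'_def)
    have c1: "- f + g = c" by (simp add: gf(1) add.assoc[symmetric])
    show False
    proof (cases "t c < t c'")
      case True
      then show ?thesis using g F(1) c c1 by (auto simp: mem_cell_iff)
    next
      case False
      then have eq: "t c = t c'" using c by simp
      have "- f + f' + c' = c" using c1 gf(2) by (simp add: add.assoc)
      moreover have "f \<noteq> f'" using gf c(3) by auto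
      ultimately show ?thesis
        using rule[of c'] F eq c(1) unfolding cover_rule_def shift_def by force
    qed
  qed
  show ?thesis
    using main[of c c'] main[of c' c] assms(2-4) by (cases "t c \<le> t c'") auto
qed

text \<open>
  The cells are disjoint and each has at least \<open>\<eta> * card F\<close> points, which bounds the number of centres
  without any bound on the overlap of the tiles.
\<close>

lemma card_centres_le:
  fixes t :: "'g::group_add \<Rightarrow> nat"
  assumes rule: "\<And>g. cover_rule F \<eta> (shift g t)" and F: "finite F" and Z: "finite Z"
  shows "card {c \<in> Z. 0 < t c} * (\<eta> * real (card F)) \<le> card (F + Z)"
proof -
  define C where "C = {c \<in> Z. 0 < t c}"
  have finC: "finite C" using Z by (simp add: C_def)
  have "card C * (\<eta> * real (card F)) = (\<Sum>c\<in>C. \<eta> * real (card F))" by simp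
  also have "\<dots> \<le> (\<Sum>c\<in>C. real (card (cell F t c)))"
  proof (rule sum_mono)
    fix c assume "c \<in> C"
    then show "\<eta> * real (card F) \<le> card (cell F t c)"
      using rule[of c] by (simp add: cover_rule_def card_cell C_def shift_def)
  qed
  also have "\<dots> = card (\<Union>c\<in>C. cell F t c)"
  proof -
    have "finite (cell F t c)" for c using F by (simp add: cell_def shape_def)
    moreover have "\<forall>c\<in>C. \<forall>c'\<in>C. c \<noteq> c' \<longrightarrow> cell F t c \<inter> cell F t c' = {}"
      using cells_disjoint[OF rule] by (auto simp: C_def)
    ultimately show ?thesis using finC by (subst card_UN_disjoint) auto
  qed
  also have "\<dots> \<le> card (F + Z)"
  proof -
    have "(\<Union>c\<in>C. cell F t c) \<subseteq> F + Z"
      using cell_subset by (fastforce simp: C_def set_plus_def)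
    then show ?thesis using F Z by (intro of_nat_mono card_mono finite_set_plus)
  qed
  finally show ?thesis by (simp add: C_def)
qed

lemma maximal_disjoint_translates:
  fixes F E :: "'g::group_add set"
  obtains C where "C \<subseteq> E" "\<And>c c'. c \<in> C \<Longrightarrow> c' \<in> C \<Longrightarrow> c \<noteq> c' \<Longrightarrow> (F + {c}) \<inter> (F + {c'}) = {}"
    "\<And>e. e \<in> E \<Longrightarrow> e \<notin> C \<Longrightarrow> \<exists>c\<in>C. (F + {c}) \<inter> (F + {e}) \<noteq> {}"
proof -
  define S where "S = {C. C \<subseteq> E \<and> pairwise (\<lambda>c c'. (F + {c}) \<inter> (F + {c'}) = {}) C}"
  have "\<exists>M\<in>S. \<forall>X\<in>S. M \<subseteq> X \<longrightarrow> X = M"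
  proof (rule subset_Zorn_nonempty)
    show "S \<noteq> {}" by (auto simp: S_def)
    fix \<C> assume "\<C> \<noteq> {}" and ch: "subset.chain S \<C>"
    have "pairwise (\<lambda>c c'. (F + {c}) \<inter> (F + {c'}) = {}) (\<Union>\<C>)"
    proof (rule pairwise_chain_Union)
      show "chain\<^sub>\<subseteq> \<C>" using subset.chain_total[OF ch] by (auto simp: chain_subset_def)
      show "pairwise (\<lambda>c c'. (F + {c}) \<inter> (F + {c'}) = {}) C" if "C \<in> \<C>" for C
        using ch that by (auto simp: S_def subset.chain_def)
    qed
    then show "\<Union>\<C> \<in> S" using ch by (auto simp: S_def subset.chain_def)
  qed
  then obtain C where C: "C \<in> S" "\<And>X. X \<in> S \<Longrightarrow> C \<subseteq> X \<Longrightarrow> X = C" by blast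
  show thesis
  proof (rule that)
    show "C \<subseteq> E" using C(1) by (simp add: S_def)
    show "(F + {c}) \<inter> (F + {c'}) = {}" if "c \<in> C" "c' \<in> C" "c \<noteq> c'" for c c'
      using C(1) that by (auto simp: S_def pairwise_def)
    fix e assume e: "e \<in> E" "e \<notin> C"
    show "\<exists>c\<in>C. (F + {c}) \<inter> (F + {e}) \<noteq> {}"
    proof (rule ccontr)
      assume "\<not> ?thesis"
      then have "insert e C \<in> S" using C(1) e(1) by (auto simp: S_def pairwise_insert)
      then show False using C(2)[of "insert e C"] e(2) by blast
    qed
  qed
qed

lemma translates_meet_iff:
  fixes F :: "'g::group_add set"
  shows "(F + {c'}) \<inter> (F + {c}) \<noteq> {} \<longleftrightarrow> (\<exists>f\<in>F. \<exists>f'\<in>F. c' = - f' + f + c)"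
proof -
  have "f' + c' = f + c \<longleftrightarrow> c' = - f' + f + c" for f f'
    by (metis add.assoc add_minus_cancel minus_add_cancel)
  then show ?thesis by (auto simp: set_plus_def)
qed

text \<open>
  The last condition is what makes the process stop: a translate with many uncovered points has been
  blocked once for every colour, each time by another tile meeting it. The step adds as colour \<open>Suc n\<close>
  a maximal disjoint family of translates that still have many uncovered points. A centre of an
  earlier colour is not affected, because the new colour is larger than its own.
\<close>

lemma partial_coloured_cover:
  fixes F :: "'g::group_add set"
  assumes F: "finite F" "F \<noteq> {}" and \<eta>: "\<eta> > 0"
  shows "\<exists>t :: 'g \<Rightarrow> nat. (\<forall>g. t g \<le> n) \<and>
    (\<forall>c. 0 < t c \<longrightarrow> \<eta> * real (card F) \<le> card (shape F (shift c t)) \<and>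
        (\<forall>c'. c' \<noteq> c \<longrightarrow> t c' = t c \<longrightarrow> (F + {c'}) \<inter> (F + {c}) = {})) \<and>
    (\<forall>c. \<eta> * real (card F) \<le> card (uncovered F (shift c t)) \<longrightarrow>
        (\<forall>i\<in>{1..n}. \<exists>c'. t c' = i \<and> (F + {c'}) \<inter> (F + {c}) \<noteq> {}))"
proof (induction n)
  case 0
  show ?case by (intro exI[of _ "\<lambda>_. 0"]) auto
next
  case (Suc n)
  then obtain t :: "'g \<Rightarrow> nat" where t: "\<And>g. t g \<le> n"
    "\<And>c. 0 < t c \<Longrightarrow> \<eta> * real (card F) \<le> card (shape F (shift c t))"
    "\<And>c c'. 0 < t c \<Longrightarrow> c' \<noteq> c \<Longrightarrow> t c' = t c \<Longrightarrow> (F + {c'}) \<inter> (F + {c}) = {}"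
    "\<And>c i. \<eta> * real (card F) \<le> card (uncovered F (shift c t)) \<Longrightarrow> i \<in> {1..n} \<Longrightarrow>
       \<exists>c'. t c' = i \<and> (F + {c'}) \<inter> (F + {c}) \<noteq> {}"
    by metis
  define E where "E = {c. \<eta> * real (card F) \<le> card (uncovered F (shift c t))}"
  obtain C where C: "C \<subseteq> E"
    "\<And>c c'. c \<in> C \<Longrightarrow> c' \<in> C \<Longrightarrow> c \<noteq> c' \<Longrightarrow> (F + {c}) \<inter> (F + {c'}) = {}"
    "\<And>e. e \<in> E \<Longrightarrow> e \<notin> C \<Longrightarrow> \<exists>c\<in>C. (F + {c}) \<inter> (F + {e}) \<noteq> {}"
    using maximal_disjoint_translates[of E F] by metis
  define t' where "t' c = (if c \<in> C then Suc n else t c)" for c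
  have pos: "0 < \<eta> * real (card F)" using F \<eta> by (simp add: card_gt_0_iff)
  have covered_by_self: "uncovered F (shift c s) = {}" if "0 < s c" for s :: "'g \<Rightarrow> nat" and c
    using that by (auto simp: mem_uncovered_shift_iff) (metis add.assoc add_0 left_minus neq0_conv)
  have C0: "t c = 0" if "c \<in> C" for c
  proof (rule ccontr)
    assume "t c \<noteq> 0"
    then have "uncovered F (shift c t) = {}" by (intro covered_by_self) simp
    then show False using that C(1) pos by (auto simp: E_def)
  qed
  have shape_old: "shape F (shift c t') = shape F (shift c t)" if "0 < t c" for c
    using that C0 t(1) by (auto simp: shape_def shift_def t'_def split: if_splits)
      (metis less_Suc_eq_le not_less_eq not_less_iff_gr_or_eq le_less_trans)+
  have shape_new: "uncovered F (shift c t) \<subseteq> shape F (shift c t')" if "c \<in> C" for c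
    using that by (auto simp: shape_def uncovered_def shift_def t'_def split: if_splits)
  show ?case
  proof (intro exI[of _ t'] conjI allI impI ballI)
    show "t' g \<le> Suc n" for g using t(1)[of g] by (simp add: t'_def)
  next
    fix c assume c: "0 < t' c"
    show "\<eta> * real (card F) \<le> card (shape F (shift c t'))"
    proof (cases "c \<in> C")
      case True
      then have "\<eta> * real (card F) \<le> card (uncovered F (shift c t))" using C(1) by (auto simp: E_def)
      also have "\<dots> \<le> card (shape F (shift c t'))"
        using shape_new[OF True] F(1) by (intro of_nat_mono card_mono) (auto simp: shape_def)
      finally show ?thesis .
    next
      case False
      then show ?thesis using c t(2)[of c] shape_old[of c] by (simp add: t'_def)
    qed
  next
    fix c c' assume c: "0 < t' c" "c' \<noteq> c" "t' c' = t' c"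
    show "(F + {c'}) \<inter> (F + {c}) = {}"
    proof (cases "c \<in> C \<or> c' \<in> C")
      case True
      then have "c \<in> C" "c' \<in> C"
        using c(3) t(1)[of c] t(1)[of c'] by (auto simp: t'_def split: if_splits)
      then show ?thesis using C(2) c(2) by blast
    next
      case False
      then show ?thesis using c t(3)[of c c'] by (simp add: t'_def)
    qed
  next
    fix c i assume c: "\<eta> * real (card F) \<le> card (uncovered F (shift c t'))" and i: "i \<in> {1..Suc n}"
    have "uncovered F (shift c t') \<subseteq> uncovered F (shift c t)"
      by (auto simp: uncovered_def shift_def t'_def split: if_splits)
    then have "card (uncovered F (shift c t')) \<le> card (uncovered F (shift c t))"
      using F(1) by (intro card_mono) (auto simp: uncovered_def)
    then have E: "c \<in> E" using c by (simp add: E_def)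
    have "t' c = 0" using c pos covered_by_self[of t' c] by (cases "t' c") auto
    then have "c \<notin> C" by (auto simp: t'_def)
    show "\<exists>c'. t' c' = i \<and> (F + {c'}) \<inter> (F + {c}) \<noteq> {}"
    proof (cases "i = Suc n")
      case True
      then show ?thesis using C(3)[OF E \<open>c \<notin> C\<close>] by (auto simp: t'_def)
    next
      case False
      then have "i \<in> {1..n}" using i by auto
      then obtain c' where c': "t c' = i" "(F + {c'}) \<inter> (F + {c}) \<noteq> {}"
        using t(4)[of c i] E by (auto simp: E_def)
      then have "c' \<notin> C" using C0 i by auto
      then show ?thesis using c' by (intro exI[of _ c']) (simp add: t'_def)
    qed
  qed
qed

text \<open>
  Fewer than \<open>Suc (card F * card F)\<close> tiles can meet a given translate of \<open>F\<close>, so no translate can be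
  blocked by a tile of every colour.
\<close>

lemma coloured_cover_exists:
  fixes F :: "'g::group_add set"
  assumes F: "finite F" "F \<noteq> {}" and \<eta>: "\<eta> > 0"
  obtains t :: "'g \<Rightarrow> nat" where "\<And>g. t g \<le> Suc (card F * card F)" "\<And>g. cover_rule F \<eta> (shift g t)"
proof -
  define n where "n = Suc (card F * card F)"
  obtain t :: "'g \<Rightarrow> nat" where t: "\<And>g. t g \<le> n"
    "\<And>c. 0 < t c \<Longrightarrow> \<eta> * real (card F) \<le> card (shape F (shift c t))"
    "\<And>c c'. 0 < t c \<Longrightarrow> c' \<noteq> c \<Longrightarrow> t c' = t c \<Longrightarrow> (F + {c'}) \<inter> (F + {c}) = {}"
    "\<And>c i. \<eta> * real (card F) \<le> card (uncovered F (shift c t)) \<Longrightarrow> i \<in> {1..n} \<Longrightarrow>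
       \<exists>c'. t c' = i \<and> (F + {c'}) \<inter> (F + {c}) \<noteq> {}"
    using partial_coloured_cover[OF assms, of n] by metis
  have few: "card (uncovered F (shift c t)) < \<eta> * real (card F)" for c
  proof (rule ccontr)
    assume "\<not> ?thesis"
    then have "\<exists>c'. t c' = i \<and> (F + {c'}) \<inter> (F + {c}) \<noteq> {}" if "i \<in> {1..n}" for i
      using t(4) that by simp
    then have "{1..n} \<subseteq> (\<lambda>(f', f). t (- f' + f + c)) ` (F \<times> F)"
      by (force simp: translates_meet_iff image_iff)
    then have "card {1..n} \<le> card (F \<times> F)"
      using F(1) by (meson card_image_le card_mono finite_SigmaI finite_imageI le_trans)
    then show False by (simp add: n_def card_cartesian_product)
  qed
  have "cover_rule F \<eta> (shift g t)" for g
    unfolding cover_rule_def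
  proof (intro conjI impI ballI)
    assume "0 < shift g t 0"
    then have g: "0 < t g" by (simp add: shift_def)
    then show "\<eta> * real (card F) \<le> card (shape F (shift g t))" by (rule t(2))
    fix f f' assume f: "f \<in> F" "f' \<in> F" "f' \<noteq> f"
    have "- f' + f + g \<noteq> g"
    proof
      assume "- f' + f + g = g"
      then have "- f' + f = 0" by (metis add_0 add_right_cancel)
      then show False using f(3) by (metis add.inverse_unique minus_minus)
    qed
    moreover have "(F + {- f' + f + g}) \<inter> (F + {g}) \<noteq> {}"
      using f translates_meet_iff by blast
    ultimately show "shift g t (- f' + f) \<noteq> shift g t 0"
      using t(3)[OF g] by (auto simp: shift_def)
  next
    show "card (uncovered F (shift g t)) \<le> \<eta> * real (card F)" using few[of g] by simp
  qed
  with t(1) show thesis unfolding n_def by (rule that)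
qed

section \<open>Sparsity of the centres and of the points off the cores\<close>

lemma card_boundary_le:
  fixes J :: "'g::group_add set"
  assumes "finite J" "finite V"
  shows "card {g \<in> V. \<exists>j\<in>J. j + g \<notin> V} \<le> card J * card ((J + V) - V)"
proof -
  have "card {g \<in> V. \<exists>j\<in>J. j + g \<notin> V} \<le> card (\<Union>j\<in>J. {g \<in> V. j + g \<notin> V})"
    using assms by (intro card_mono) auto
  also have "\<dots> \<le> (\<Sum>j\<in>J. card {g \<in> V. j + g \<notin> V})"
    by (rule card_UN_le[OF assms(1)])
  also have "\<dots> \<le> (\<Sum>j\<in>J. card ((J + V) - V))"
  proof (rule sum_mono)
    fix j assume j: "j \<in> J"
    have "card {g \<in> V. j + g \<notin> V} = card ((\<lambda>g. j + g) ` {g \<in> V. j + g \<notin> V})"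
      by (intro card_image[symmetric] inj_onI) simp
    also have "\<dots> \<le> card ((J + V) - V)"
      using assms j by (intro card_mono finite_Diff finite_set_plus) auto
    finally show "card {g \<in> V. j + g \<notin> V} \<le> card ((J + V) - V)" .
  qed
  finally show ?thesis by simp
qed

text \<open>
  Double counting: each uncovered point of \<open>V\<close> lies in \<open>card F\<close> translates of \<open>F\<close>, and each translate
  has at most \<open>\<eta> * card F\<close> uncovered points.
\<close>

lemma card_uncovered_points_le:
  fixes t :: "'g::group_add \<Rightarrow> nat" and \<eta> :: real
  assumes rule: "\<And>g. cover_rule F \<eta> (shift g t)" and F: "finite F" "F \<noteq> {}" and V: "finite V"
  shows "card {g \<in> V. \<forall>f\<in>F. t (- f + g) = 0} \<le> \<eta> * card (uminus ` F + V)"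
proof -
  define U where "U = {g \<in> V. \<forall>f\<in>F. t (- f + g) = 0}"
  define Z where "Z = uminus ` F + V"
  have Z: "finite Z" using F V by (auto simp: Z_def intro: finite_set_plus)
  have pos: "0 < card F" using F by (simp add: card_gt_0_iff)
  have fin: "finite (uncovered F s)" for s using F by (simp add: uncovered_def)
  have "card F * card U = card ((\<lambda>(f, u). (- f + u, f)) ` (F \<times> U))"
    by (subst card_image) (auto simp: inj_on_def card_cartesian_product)
  also have "\<dots> \<le> card (Sigma Z (\<lambda>c. uncovered F (shift c t)))"
  proof (rule card_mono)
    show "(\<lambda>(f, u). (- f + u, f)) ` (F \<times> U) \<subseteq> Sigma Z (\<lambda>c. uncovered F (shift c t))"
      by (auto simp: U_def Z_def mem_uncovered_shift_iff add.assoc[symmetric] intro!: set_plus_intro)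
  qed (use Z fin in auto)
  also have "\<dots> = (\<Sum>c\<in>Z. card (uncovered F (shift c t)))"
    using Z fin by simp
  finally have "real (card F * card U) \<le> (\<Sum>c\<in>Z. real (card (uncovered F (shift c t))))"
    by (metis of_nat_le_iff of_nat_sum)
  also have "\<dots> \<le> (\<Sum>c\<in>Z. \<eta> * real (card F))"
    using rule by (intro sum_mono) (simp add: cover_rule_def)
  finally show ?thesis using pos by (simp add: U_def Z_def mult.assoc mult.left_commute)
qed

definition core :: "'g::group_add set \<Rightarrow> 'g set \<Rightarrow> 'g set" where
  "core K S = {s \<in> S. \<forall>k\<in>K. k + s \<in> S}"

text \<open>
  The points of the cores of those cells whose full tile lies in \<open>V\<close>. A pattern on \<open>V\<close> sees these
  cells completely, and its symbols on their cores will be redundant.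
\<close>

definition core_points :: "'g::group_add set \<Rightarrow> 'g set \<Rightarrow> ('g \<Rightarrow> nat) \<Rightarrow> 'g set \<Rightarrow> 'g set" where
  "core_points K F t V =
     {g. \<exists>c. 0 < t c \<and> F + {c} \<subseteq> V \<and> g - c \<in> core K (shape F (shift c t))}"

text \<open>
  A point of \<open>V\<close> that is no core point is uncovered, or arises by adding an element of \<open>K\<close> to a rim
  point of some tile, or its tile leaves \<open>V\<close>. The three summands bound the three cases in turn. In the
  second case the rim need not be the one of the tile owning the point: where the cell ends inside its tile, it
  ends at the rim of a tile of smaller colour. Since the number of tiles is at most
  \<open>card (F + Z) / (\<eta> * card F)\<close>, with \<open>Z\<close> the set of relevant centres, nothing more has to be known
  about how the tiles overlap.
\<close>

lemma card_non_core_points_le: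
  fixes t :: "'g::group_add \<Rightarrow> nat" and \<eta> :: real
  assumes rule: "\<And>g. cover_rule F \<eta> (shift g t)" and \<eta>: "\<eta> > 0"
    and F: "finite F" "F \<noteq> {}" and V: "finite V"
    and K: "finite K" "0 \<in> K" "\<And>k. k \<in> K \<Longrightarrow> - k \<in> K"
  shows "real (card (V - core_points K F t V))
    \<le> \<eta> * card (uminus ` F + V)
      + card K * card {f \<in> F. \<exists>k\<in>K. k + f \<notin> F} * (card (F + (uminus ` F + (K + V))) / (\<eta> * card F))
      + card (F + uminus ` F) * card (((F + uminus ` F) + V) - V)"
proof -
  define rim where "rim = {f \<in> F. \<exists>k\<in>K. k + f \<notin> F}"
  define Z where "Z = uminus ` F + (K + V)"
  define C where "C = {c \<in> Z. 0 < t c}"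
  define J where "J = F + uminus ` F"
  define U where "U = {g \<in> V. \<forall>f\<in>F. t (- f + g) = 0}"
  define D where "D = {g \<in> V. \<exists>j\<in>J. j + g \<notin> V}"
  have fin: "finite Z" "finite C" "finite J" "finite rim" "finite (K + rim)" "finite U" "finite D"
  proof -
    show "finite Z" using F V K unfolding Z_def by (intro finite_set_plus) auto
    then show "finite C" by (simp add: C_def)
    show rim: "finite rim" using F by (simp add: rim_def)
    show "finite J" "finite (K + rim)" using F K rim unfolding J_def by (intro finite_set_plus; simp)+
  qed (use V in \<open>auto simp: U_def D_def\<close>)
  have sub: "V - core_points K F t V \<subseteq> U \<union> ((K + rim) + C) \<union> D"
  proof
    fix g assume g: "g \<in> V - core_points K F t V"
    have ZI: "- f + (k + g) \<in> Z" if "f \<in> F" "k \<in> K" for f k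
      unfolding Z_def using g that by (intro set_plus_intro imageI) auto
    show "g \<in> U \<union> ((K + rim) + C) \<union> D"
    proof (cases "g \<in> U")
      case False
      \<comment> \<open>P holds for the centres of the tiles containing g. The one of least colour owns g.\<close>
      define P where "P c \<longleftrightarrow> 0 < t c \<and> g - c \<in> F" for c
      have "\<exists>c. P c"
      proof -
        obtain f where f: "f \<in> F" "t (- f + g) \<noteq> 0" using False g by (auto simp: U_def)
        then have "P (- f + g)" by (simp add: P_def diff_conv_add_uminus minus_add add.assoc[symmetric])
        then show ?thesis ..
      qed
      then obtain c where c: "P c" and least: "\<And>c'. P c' \<Longrightarrow> t c \<le> t c'"
        using ex_has_least_nat[of P _ t] by blast
      define f where "f = g - c"
      have f: "f \<in> F" "0 < t c" "g = f + c" using c by (auto simp: P_def f_def)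
      have sh: "f \<in> shape F (shift c t)"
        unfolding shape_def
      proof (intro CollectI conjI ballI f(1) notI)
        fix f' assume f': "f' \<in> F" "0 < shift c t (- f' + f) \<and> shift c t (- f' + f) < shift c t 0"
        then have "0 < t (- f' + g)" "t (- f' + g) < t c" by (auto simp: shift_def f(3) add.assoc)
        moreover have "g - (- f' + g) = f'" by (simp add: diff_conv_add_uminus minus_add add.assoc[symmetric])
        ultimately show False using least[of "- f' + g"] f'(1) by (auto simp: P_def)
      qed
      show ?thesis
      proof (cases "F + {c} \<subseteq> V")
        case out: False
        then obtain f1 where f1: "f1 \<in> F" "f1 + c \<notin> V" by (auto simp: set_plus_def)
        have "f1 + - f + g = f1 + c" by (simp add: f(3) add.assoc[symmetric])
        moreover have "f1 + - f \<in> J" unfolding J_def using f f1 by (intro set_plus_intro) auto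
        ultimately have "\<exists>j\<in>J. j + g \<notin> V" using f1(2) by metis
        then have "g \<in> D" using g by (simp add: D_def)
        then show ?thesis by blast
      next
        case True
        then have "f \<notin> core K (shape F (shift c t))"
          using g f(2) unfolding core_points_def f_def by blast
        then obtain k where k: "k \<in> K" "k + f \<notin> shape F (shift c t)"
          using sh by (auto simp: core_def)
        show ?thesis
        proof (cases "k + f \<in> F")
          case False
          then have "f \<in> rim" using f k by (auto simp: rim_def)
          moreover have "c \<in> C"
            using ZI[OF f(1) K(2)] f by (simp add: C_def add.assoc[symmetric])
          moreover have "g = (0 + f) + c" using f by simp
          ultimately show ?thesis using K(2) by (metis UnCI set_plus_intro)
        next
          case True
          then obtain f' where f': "f' \<in> F" "0 < t (- f' + (k + f) + c)" "t (- f' + (k + f) + c) < t c"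
            using k by (auto simp: shape_def shift_def)
          define c' where "c' = - f' + (k + g)"
          have c': "0 < t c'" "t c' < t c"
            using f' by (simp_all add: c'_def f(3) add.assoc)
          \<comment> \<open>The point k + g has crossed into the tile of the smaller colour t c'. As g is not in that tile,
            - k + f' is not in F, so f' is on the rim.\<close>
          have eq: "g = - k + f' + c'"
            by (simp add: c'_def add.assoc)
          have "- k + f' \<notin> F"
          proof
            assume "- k + f' \<in> F"
            moreover have "g - c' = - k + f'" by (subst eq) simp
            ultimately show False using least[of c'] c' by (simp add: P_def)
          qed
          then have "f' \<in> rim" using f' k K by (auto simp: rim_def)
          moreover have "c' \<in> C" using ZI f' k c' by (simp add: C_def c'_def)
          ultimately show ?thesis using K(3)[OF k(1)] eq by (metis UnCI set_plus_intro)
        qed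
      qed
    qed simp
  qed
  have pos: "0 < \<eta> * real (card F)" using F \<eta> by (simp add: card_gt_0_iff)
  have C: "real (card C) \<le> card (F + Z) / (\<eta> * card F)"
    using card_centres_le[OF rule F(1) fin(1)] pos by (simp add: C_def pos_le_divide_eq)
  have plus_le: "card (P + Q) \<le> card P * card Q" if "finite P" "finite Q" for P Q :: "'g set"
  proof -
    have "P + Q = (\<lambda>(p, q). p + q) ` (P \<times> Q)" by (auto simp: set_plus_def)
    then show ?thesis using that by (metis card_cartesian_product card_image_le finite_cartesian_product)
  qed
  have "card (V - core_points K F t V) \<le> card (U \<union> ((K + rim) + C) \<union> D)"
    using fin sub by (intro card_mono) (auto intro: finite_set_plus)
  also have "\<dots> \<le> card U + card ((K + rim) + C) + card D"
    by (meson add_mono_thms_linordered_semiring(3) card_Un_le le_trans)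
  also have "\<dots> \<le> card U + card K * card rim * card C + card J * card ((J + V) - V)"
  proof -
    have "card ((K + rim) + C) \<le> card (K + rim) * card C" using fin by (intro plus_le)
    also have "\<dots> \<le> card K * card rim * card C" using fin K by (intro mult_right_mono plus_le) auto
    finally show ?thesis using card_boundary_le[OF fin(3) V] by (simp add: D_def)
  qed
  finally have "real (card (V - core_points K F t V))
      \<le> real (card U + card K * card rim * card C + card J * card ((J + V) - V))"
    by (rule of_nat_mono)
  also have "\<dots> = real (card U) + real (card K * card rim) * real (card C) + card J * card ((J + V) - V)"
    by simp
  also have "\<dots> \<le> \<eta> * card (uminus ` F + V) + real (card K * card rim) * (card (F + Z) / (\<eta> * card F))
      + card J * card ((J + V) - V)"
    using card_uncovered_points_le[OF rule F V] C
    by (intro add_mono mult_left_mono) (auto simp: U_def)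
  finally show ?thesis by (simp add: rim_def Z_def J_def)
qed

text \<open>
  Chernoff's method: give a function the weight \<open>\<theta>\<close> to the power of its number of nonzero values. The
  total weight of all functions \<open>V \<rightarrow> {0..L}\<close> is \<open>(1 + L * \<theta>) ^ card V\<close>, and a function with at
  most \<open>\<kappa>\<close> nonzero values has weight at least \<open>\<theta> powr \<kappa>\<close>.
\<close>

lemma card_sparse_restr_le:
  fixes T :: "('g \<Rightarrow> nat) set" and L :: nat and \<theta> \<kappa> :: real
  assumes V: "finite V" and \<theta>: "0 < \<theta>" "\<theta> \<le> 1"
    and L: "\<And>t g. t \<in> T \<Longrightarrow> t g \<le> L" and sparse: "\<And>t. t \<in> T \<Longrightarrow> real (card {v \<in> V. 0 < t v}) \<le> \<kappa>"
  shows "real (card ((\<lambda>t. restr t V) ` T)) \<le> exp (L * \<theta> * card V + \<kappa> * ln (1 / \<theta>))"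
proof -
  define P where "P = (\<lambda>t. restrict t V) ` T"
  define Q where "Q = PiE V (\<lambda>_. {..L})"
  have Q: "finite Q" using V by (simp add: Q_def finite_PiE)
  have PQ: "P \<subseteq> Q" using L by (auto simp: P_def Q_def)
  have finP: "finite P" using PQ Q by (rule finite_subset)
  \<comment> \<open>w f is \<theta> to the power of the number of nonzero values of f, in product form.\<close>
  define w where "w f = (\<Prod>v\<in>V. if f v = 0 then 1 else \<theta>)" for f :: "'g \<Rightarrow> nat"
  have w: "w f = \<theta> ^ card {v \<in> V. 0 < f v}" for f
  proof -
    have "w f = (\<Prod>v\<in>{v \<in> V. 0 < f v}. \<theta>)"
      unfolding w_def by (intro prod.mono_neutral_cong_right) (use V in auto)
    then show ?thesis by simp
  qed
  have "card P * \<theta> powr \<kappa> = (\<Sum>f\<in>P. \<theta> powr \<kappa>)" by simp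
  also have "\<dots> \<le> (\<Sum>f\<in>P. w f)"
  proof (rule sum_mono)
    fix f assume "f \<in> P"
    then obtain t where t: "t \<in> T" "f = restrict t V" by (auto simp: P_def)
    have "{v \<in> V. 0 < f v} = {v \<in> V. 0 < t v}" by (auto simp: t)
    then have "real (card {v \<in> V. 0 < f v}) \<le> \<kappa>" using sparse[OF t(1)] by simp
    then have "\<theta> powr \<kappa> \<le> \<theta> powr (card {v \<in> V. 0 < f v})"
      using \<theta> by (intro powr_mono') auto
    then show "\<theta> powr \<kappa> \<le> w f" using \<theta> by (simp add: w powr_realpow)
  qed
  also have "\<dots> \<le> (\<Sum>f\<in>Q. w f)"
    using \<theta> by (intro sum_mono2 Q PQ) (simp add: w)
  also have "\<dots> = (\<Prod>v\<in>V. \<Sum>i\<le>L. if i = 0 then 1 else \<theta>)"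
    unfolding Q_def w_def using V by (subst prod_sum_PiE) auto
  also have "(\<Sum>i\<le>L. if i = 0 then 1 else \<theta>) = 1 + L * \<theta>"
    by (simp add: sum.atMost_shift)
  also have "(\<Prod>v\<in>V. 1 + real L * \<theta>) \<le> (\<Prod>v\<in>V. exp (L * \<theta>))"
    using \<theta> by (intro prod_mono) (auto simp: exp_ge_add_one_self add_nonneg_nonneg)
  also have "\<dots> = exp (L * \<theta> * card V)" by (simp add: exp_of_nat_mult[symmetric] mult_ac)
  finally have "card P * \<theta> powr \<kappa> \<le> exp (L * \<theta> * card V)" .
  then have "card P \<le> exp (L * \<theta> * card V) / \<theta> powr \<kappa>"
    using \<theta> by (simp add: pos_le_divide_eq)
  also have "\<dots> = exp (L * \<theta> * card V + \<kappa> * ln (1 / \<theta>))"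
    using \<theta> by (simp add: powr_def exp_add ln_div exp_diff)
  finally have "real (card P) \<le> exp (L * \<theta> * card V + \<kappa> * ln (1 / \<theta>))" .
  moreover have "card ((\<lambda>t. restr t V) ` T) \<le> card P"
    unfolding P_def using finP[unfolded P_def]
    by (rule card_image_le_if_determines) (metis restr_eq_iff restrict_apply')
  ultimately show ?thesis by linarith
qed

section \<open>Canonical fillings of cells\<close>

text \<open>
  A shift of finite type with a block map: \<open>R\<close> is the condition that the configurations satisfy at
  every point, and \<open>\<Phi>\<close> gives the symbol of the image at the origin. Both look at the window \<open>M\<close>.
\<close>

locale local_presentation =
  fixes A :: "'a set" and M :: "'g::group_add set"
    and R :: "('g \<Rightarrow> 'a) \<Rightarrow> bool" and \<Phi> :: "('g \<Rightarrow> 'a) \<Rightarrow> 'b"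
  assumes finite_A: "finite A" and finite_M: "finite M" and zero_M: "0 \<in> M"
    and R_window: "depends_on M R" and \<Phi>_window: "depends_on M \<Phi>"
begin

definition X :: "('g \<Rightarrow> 'a) set" where
  "X = {x. range x \<subseteq> A \<and> (\<forall>g. R (shift g x))}"

text \<open>
  The points of a window \<open>M + {h}\<close> arise from any one of them by adding elements of this set on the
  left. Thus every window that meets \<open>core K S\<close> is contained in \<open>S\<close>.
\<close>

definition K :: "'g set" where
  "K = M + uminus ` M"

text \<open>
  The admissible ways to refill \<open>S\<close> given \<open>z\<close>. Only the values of \<open>z\<close> off the core and the symbols of
  the image that are computed inside \<open>S\<close> enter (\<open>variants_cong\<close>). Hence any two configurations
  agreeing in these data are assigned the same element by the choice in \<open>canon\<close>.
\<close>

definition variants :: "'g set \<Rightarrow> ('g \<Rightarrow> 'a) \<Rightarrow> ('g \<Rightarrow> 'a) set" where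
  "variants S z = {y. range y \<subseteq> A \<and> (\<forall>s\<in>S - core K S. y s = z s) \<and>
     (\<forall>h. M + {h} \<subseteq> S \<longrightarrow> R (shift h y) \<and> \<Phi> (shift h y) = \<Phi> (shift h z))}"

definition canon :: "'g set \<Rightarrow> ('g \<Rightarrow> 'a) \<Rightarrow> ('g \<Rightarrow> 'a)" where
  "canon S z = (SOME y. y \<in> variants S z)"

definition canonical :: "'g set \<Rightarrow> ('g \<Rightarrow> nat) \<Rightarrow> ('g \<Rightarrow> 'a) \<Rightarrow> bool" where
  "canonical F t x \<longleftrightarrow>
     (0 < t 0 \<longrightarrow> (\<forall>s\<in>core K (shape F t). x s = canon (shape F t) x s))"

lemma finite_K: "finite K"
  using finite_M by (auto simp: K_def intro: finite_set_plus)

lemma diff_mem_K: "m \<in> M \<Longrightarrow> m' \<in> M \<Longrightarrow> m - m' \<in> K"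
  using set_plus_intro[of m M "- m'" "uminus ` M"] by (simp add: K_def)

lemma zero_K: "0 \<in> K"
  using diff_mem_K[OF zero_M zero_M] by simp

lemma minus_K: "k \<in> K \<Longrightarrow> - k \<in> K"
proof -
  assume "k \<in> K"
  then obtain m m' where m: "m \<in> M" "m' \<in> M" "k = m + - m'" by (auto simp: K_def set_plus_def)
  then have "- k = m' - m" by simp
  then show "- k \<in> K" using diff_mem_K m by simp
qed

lemma variants_cong:
  assumes "\<And>s. s \<in> S - core K S \<Longrightarrow> z s = z' s"
    and "\<And>h. M + {h} \<subseteq> S \<Longrightarrow> \<Phi> (shift h z) = \<Phi> (shift h z')"
  shows "variants S z = variants S z'"
  using assms unfolding variants_def by auto

lemma canon_cong:
  assumes "\<And>s. s \<in> S - core K S \<Longrightarrow> z s = z' s"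
    and "\<And>h. M + {h} \<subseteq> S \<Longrightarrow> \<Phi> (shift h z) = \<Phi> (shift h z')"
  shows "canon S z = canon S z'"
  using variants_cong[OF assms] by (simp add: canon_def)

lemma \<Phi>_shift_cong:
  assumes "M + {h} \<subseteq> S" "\<And>s. s \<in> S \<Longrightarrow> z s = z' s"
  shows "\<Phi> (shift h z) = \<Phi> (shift h z')"
  using assms by (intro depends_onD[OF \<Phi>_window]) (auto simp: shift_def)

lemma canonical_cong:
  assumes "\<And>d. d \<in> uminus ` F + F \<Longrightarrow> t d = t' d" "\<And>f. f \<in> F \<Longrightarrow> x f = x' f" "t 0 = t' 0"
  shows "canonical F t x = canonical F t' x'"
proof -
  have sh: "shape F t = shape F t'"
    using assms(1,3) unfolding shape_def by (metis (no_types, lifting) imageI set_plus_intro)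
  have F: "shape F t' \<subseteq> F" by (auto simp: shape_def)
  then have "canon (shape F t') x = canon (shape F t') x'"
    using assms(2) by (intro canon_cong \<Phi>_shift_cong) (auto simp: subset_iff)
  then show ?thesis using assms(2,3) F by (auto simp: canonical_def sh core_def subset_iff)
qed

lemma shift_mem_X: "x \<in> X \<Longrightarrow> shift g x \<in> X"
  unfolding X_def by (force simp: shift_def add.assoc)

lemma canon_mem_variants:
  assumes "x \<in> X"
  shows "canon S x \<in> variants S x"
proof -
  have "x \<in> variants S x" using assms by (auto simp: X_def variants_def)
  then show ?thesis unfolding canon_def by (rule someI[of "\<lambda>y. y \<in> variants S x"])
qed

text \<open>
  Refill the cores of all cells canonically at once. A window that meets a core lies in the
  corresponding cell, where the new configuration is an element of \<open>variants\<close>; any other window sees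
  the old configuration. So neither the local condition nor the image can be violated or changed.
  Since the data off the cores and the image are kept, the choice of the canonical filling for the
  new configuration is the same as for the old one.
\<close>

lemma canonical_representative_exists:
  assumes x: "x \<in> X" and rule: "\<And>g. cover_rule F \<eta> (shift g t)"
  obtains y where "y \<in> X" "\<And>g. \<Phi> (shift g y) = \<Phi> (shift g x)"
    "\<And>g. canonical F (shift g t) (shift g y)"
proof -
  define S where "S c = shape F (shift c t)" for c
  define p where "p c = canon (S c) (shift c x)" for c
  define in_core where "in_core g c \<longleftrightarrow> 0 < t c \<and> g - c \<in> core K (S c)" for g c
  define y where "y g = (if \<exists>c. in_core g c then (let c = SOME c. in_core g c in p c (g - c)) else x g)" for g
  have p: "p c \<in> variants (S c) (shift c x)" for c
    unfolding p_def using x by (intro canon_mem_variants shift_mem_X)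
  have cell: "g \<in> cell F t c" if "in_core g c" for g c
    using that by (force simp: in_core_def core_def cell_def S_def image_iff)
  have unique: "c' = c" if "in_core g c'" "0 < t c" "g \<in> cell F t c" for g c c'
    using cells_disjoint[OF rule, of c' c] that cell[OF that(1)] by (auto simp: in_core_def)
  have y_core: "y g = p c (g - c)" if "in_core g c" for g c
  proof -
    have "in_core g (SOME c. in_core g c)" using that by (rule someI)
    then have "(SOME c. in_core g c) = c" using unique cell[OF that] that by (auto simp: in_core_def)
    then show ?thesis using that by (auto simp: y_def)
  qed
  have y_off: "y (s + c) = x (s + c)" if "0 < t c" "s \<in> S c - core K (S c)" for s c
  proof -
    have "s + c \<in> cell F t c" using that by (auto simp: cell_def S_def)
    then have "\<not> in_core (s + c) c'" for c'
      using unique[of "s + c" c' c] that by (auto simp: in_core_def)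
    then show ?thesis by (simp add: y_def)
  qed
  have y_shape: "y (s + c) = p c s" if "0 < t c" "s \<in> S c" for s c
  proof (cases "s \<in> core K (S c)")
    case True
    then show ?thesis using that y_core[of "s + c" c] by (simp add: in_core_def)
  next
    case False
    then have "p c s = shift c x s" using p[of c] that by (auto simp: variants_def)
    then show ?thesis using y_off[of c s] False that by (simp add: shift_def)
  qed
  have loc: "R (shift g y) \<and> \<Phi> (shift g y) = \<Phi> (shift g x)" for g
  proof (cases "\<exists>m\<in>M. \<exists>c. in_core (m + g) c")
    case True
    then obtain m c where m: "m \<in> M" "0 < t c" "m + g - c \<in> core K (S c)" by (auto simp: in_core_def)
    \<comment> \<open>The window at g meets the core of the cell of c, so it lies in this cell.\<close>
    have sub: "m' + (g - c) \<in> S c" if "m' \<in> M" for m'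
    proof -
      have "m' - m \<in> K" using that m by (intro diff_mem_K)
      then have "(m' - m) + (m + g - c) \<in> S c" using m unfolding core_def by blast
      moreover have "(m' - m) + (m + g - c) = m' + (g - c)"
        by (simp add: add_diff_eq add.assoc[symmetric])
      ultimately show ?thesis by simp
    qed
    then have "M + {g - c} \<subseteq> S c" by (auto simp: set_plus_def)
    then have "R (shift (g - c) (p c))" "\<Phi> (shift (g - c) (p c)) = \<Phi> (shift (g - c) (shift c x))"
      using p[of c] by (auto simp: variants_def)
    moreover have agree: "shift g y m' = shift (g - c) (p c) m'" if "m' \<in> M" for m'
      using y_shape[OF m(2) sub[OF that]] by (simp add: shift_def add.assoc)
    ultimately show ?thesis
      using depends_onD[OF R_window, of "shift g y" "shift (g - c) (p c)"]
        depends_onD[OF \<Phi>_window, of "shift g y" "shift (g - c) (p c)"] by simp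
  next
    case False
    then have "shift g y m = shift g x m" if "m \<in> M" for m
    proof -
      have "\<not> (\<exists>c. in_core (m + g) c)" using False that by blast
      then have "y (m + g) = x (m + g)" unfolding y_def by (rule if_not_P)
      then show ?thesis by (simp add: shift_def)
    qed
    then have "R (shift g y) = R (shift g x)" "\<Phi> (shift g y) = \<Phi> (shift g x)"
      using depends_onD[OF R_window] depends_onD[OF \<Phi>_window] by blast+
    then show ?thesis using x by (simp add: X_def)
  qed
  show thesis
  proof (rule that)
    have "y g \<in> A" for g
    proof (cases "\<exists>c. in_core g c")
      case True
      then obtain c where "y g = p c (g - c)" using y_core by blast
      then show ?thesis using p[of c] by (auto simp: variants_def)
    next
      case False
      then show ?thesis using x by (auto simp: y_def X_def)
    qed
    then show "y \<in> X" using loc by (auto simp: X_def)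
    show "\<Phi> (shift g y) = \<Phi> (shift g x)" for g using loc by blast
    show "canonical F (shift g t) (shift g y)" for g
      unfolding canonical_def
    proof (intro impI ballI)
      fix s assume "0 < shift g t 0" and s: "s \<in> core K (shape F (shift g t))"
      then have g: "0 < t g" by (simp add: shift_def)
      have "canon (S g) (shift g y) = p g"
        unfolding p_def
      proof (rule canon_cong)
        show "shift g y s = shift g x s" if "s \<in> S g - core K (S g)" for s
          using y_off[OF g that] by (simp add: shift_def)
        show "\<Phi> (shift h (shift g y)) = \<Phi> (shift h (shift g x))" for h
          using loc by simp
      qed
      then show "shift g y s = canon (shape F (shift g t)) (shift g y) s"
        using y_shape[OF g, of s] s by (simp add: S_def core_def shift_def)
    qed
  qed
qed

text \<open>
  A core symbol is read off from the canonical filling, which is the same for both configurations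
  because the symbols off the core and the image agree on the cell.
\<close>

lemma canonical_determined:
  assumes rule: "\<And>g. cover_rule F \<eta> (shift g t)"
    and t: "\<And>d. d \<in> uminus ` F + V \<Longrightarrow> t d = t' d"
    and x: "\<And>g. canonical F (shift g t) (shift g x)"
    and y: "\<And>g. canonical F (shift g t') (shift g y)"
    and im: "\<And>g. g \<in> V \<Longrightarrow> \<Phi> (shift g x) = \<Phi> (shift g y)"
    and off: "\<And>g. g \<in> V - core_points K F t V \<Longrightarrow> x g = y g"
    and g: "g \<in> V"
  shows "x g = y g"
proof (cases "g \<in> core_points K F t V")
  case True
  then obtain c where c: "0 < t c" "F + {c} \<subseteq> V" "g - c \<in> core K (shape F (shift c t))"
    by (auto simp: core_points_def)
  define S where "S = shape F (shift c t)"
  have SF: "S \<subseteq> F" by (auto simp: S_def shape_def)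
  have SV: "s + c \<in> V" if "s \<in> S" for s using c(2) SF that by (auto simp: set_plus_def)
  have gS: "g - c \<in> S" using c by (simp add: core_def S_def)
  have eq: "shift c t (- f' + f) = shift c t' (- f' + f)" if "f \<in> F" "f' \<in> F" for f f'
  proof -
    have "f + c \<in> V" using c(2) that by (auto simp: set_plus_def)
    then have "- f' + (f + c) \<in> uminus ` F + V" using that by (auto intro: set_plus_intro)
    then show ?thesis using t by (simp add: shift_def add.assoc)
  qed
  have eq0: "shift c t 0 = shift c t' 0" using eq[of "g - c" "g - c"] gS SF by (metis left_minus subsetD)
  have S': "shape F (shift c t') = S" using eq eq0 by (auto simp: S_def shape_def)
  have "canon S (shift c x) = canon S (shift c y)"
  proof (rule canon_cong)
    fix s assume s: "s \<in> S - core K S"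
    have "s + c \<notin> core_points K F t V"
    proof
      assume "s + c \<in> core_points K F t V"
      then obtain c' where c': "0 < t c'" "s + c - c' \<in> core K (shape F (shift c' t))"
        by (auto simp: core_points_def)
      have "s + c \<in> cell F t c'" using c' by (force simp: core_def cell_def image_iff)
      moreover have "s + c \<in> cell F t c" using s by (auto simp: cell_def S_def)
      ultimately have "c' = c" using cells_disjoint[OF rule c'(1) c(1)] by blast
      then show False using c' s by (simp add: S_def)
    qed
    then show "shift c x s = shift c y s" using off SV s by (simp add: shift_def)
  next
    fix h assume "M + {h} \<subseteq> S"
    then have "h \<in> S" using zero_M by (auto simp: set_plus_def)
    then show "\<Phi> (shift h (shift c x)) = \<Phi> (shift h (shift c y))" using im SV by simp
  qed
  moreover have "shift c x (g - c) = canon S (shift c x) (g - c)"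
    using x[of c] c by (simp add: canonical_def S_def shift_def[of c t])
  moreover have "shift c y (g - c) = canon S (shift c y) (g - c)"
    using y[of c] c eq0 S' by (simp add: canonical_def S_def shift_def[of c t] shift_def[of c t'])
  ultimately show ?thesis by (simp add: shift_def)
qed (use off g in simp)

end

section \<open>The recoded shift of finite type\<close>

lemma card_restr_image_le:
  assumes A: "finite A" and D: "finite D" and S: "\<And>x. x \<in> S \<Longrightarrow> range x \<subseteq> A"
  shows "card ((\<lambda>x. restr x D) ` S) \<le> card A ^ card D"
proof -
  have sub: "(\<lambda>x. restrict x D) ` S \<subseteq> PiE D (\<lambda>_. A)" using S by (auto simp: subset_iff)
  have fin: "finite (PiE D (\<lambda>_. A))" using A D by (simp add: finite_PiE)
  have "card ((\<lambda>x. restr x D) ` S) \<le> card ((\<lambda>x. restrict x D) ` S)"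
    using finite_subset[OF sub fin]
    by (rule card_image_le_if_determines) (metis restr_eq_iff restrict_apply')
  also have "\<dots> \<le> card (PiE D (\<lambda>_. A))" using fin sub by (rule card_mono)
  finally show ?thesis using D by (simp add: card_PiE)
qed

lemma card_image_Pair_le:
  assumes "finite (f ` S)" "\<And>u. card (g ` {x \<in> S. f x = u}) \<le> n" "\<And>u. finite (g ` {x \<in> S. f x = u})"
  shows "card ((\<lambda>x. (f x, g x)) ` S) \<le> card (f ` S) * n"
proof -
  have "card ((\<lambda>x. (f x, g x)) ` S) \<le> card (Sigma (f ` S) (\<lambda>u. g ` {x \<in> S. f x = u}))"
    using assms by (intro card_mono finite_SigmaI) auto
  also have "\<dots> = (\<Sum>u\<in>f ` S. card (g ` {x \<in> S. f x = u}))"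
    using assms by simp
  also have "\<dots> \<le> card (f ` S) * n" using assms(2) by (intro sum_bounded_above[of "f ` S" _ n, simplified])
  finally show ?thesis .
qed

lemma core_points_cong:
  fixes F :: "'g::group_add set"
  assumes "\<And>d. d \<in> uminus ` F + V \<Longrightarrow> t d = t' d"
  shows "core_points K F t V = core_points K F t' V"
proof -
  have "core_points K F t V \<subseteq> core_points K F t' V"
    if tt: "\<And>d. d \<in> uminus ` F + V \<Longrightarrow> t d = t' d" for t t' :: "'g \<Rightarrow> nat"
  proof
    fix g assume "g \<in> core_points K F t V"
    then obtain c where c: "0 < t c" "F + {c} \<subseteq> V" "g - c \<in> core K (shape F (shift c t))"
      by (auto simp: core_points_def)
    have eq: "t (- f' + f + c) = t' (- f' + f + c)" if "f \<in> F" "f' \<in> F" for f f'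
    proof -
      have "f + c \<in> V" using c(2) that by (auto simp: set_plus_def)
      then have "- f' + (f + c) \<in> uminus ` F + V" using that by (auto intro: set_plus_intro)
      then show ?thesis using tt by (simp add: add.assoc)
    qed
    have "g - c \<in> F" using c by (auto simp: core_def shape_def)
    from eq[OF this this] have c0: "t c = t' c" by (simp only: left_minus add_0)
    have "shape F (shift c t) = shape F (shift c t')"
      unfolding shape_def using eq c0 by (auto simp: shift_def)
    then show "g \<in> core_points K F t' V" using c c0 by (auto simp: core_points_def)
  qed
  from this[of t t'] this[of t' t] show ?thesis using assms by auto
qed

lemma continuous_map_one_block:
  assumes X: "\<And>x. x \<in> X \<Longrightarrow> range x \<subseteq> A" and p: "p \<in> A \<rightarrow> B" and W: "\<And>x. x \<in> X \<Longrightarrow> (\<lambda>g. p (x g)) \<in> W"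
  shows "continuous_map (subtopology (full_shift A) X) (subtopology (full_shift B) W) (\<lambda>x g. p (x g))"
  unfolding continuous_map_in_subtopology
proof
  have "continuous_map (full_shift A) (full_shift B) (\<lambda>x g. p (x g))"
    unfolding full_shift_def continuous_map_componentwise_UNIV
  proof
    fix k
    have "continuous_map (product_topology (\<lambda>_. discrete_topology A) UNIV) (discrete_topology A) (\<lambda>x. x k)"
      by (rule continuous_map_product_projection) simp
    moreover have "continuous_map (discrete_topology A) (discrete_topology B) p"
      using p by auto
    ultimately have "continuous_map (product_topology (\<lambda>_. discrete_topology A) UNIV) (discrete_topology B) (p \<circ> (\<lambda>x. x k))"
      by (rule continuous_map_compose)
    then show "continuous_map (product_topology (\<lambda>_. discrete_topology A) UNIV) (discrete_topology B) (\<lambda>x. p (x k))"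
      by (simp add: o_def)
  qed
  then show "continuous_map (subtopology (full_shift A) X) (full_shift B) (\<lambda>x g. p (x g))"
    by (rule continuous_map_from_subtopology)
  show "(\<lambda>x g. p (x g)) \<in> topspace (subtopology (full_shift A) X) \<rightarrow> W"
    using W by auto
qed

text \<open>
  The bijection \<open>d\<close> decodes a natural number into a symbol of \<open>X\<close>, the corresponding symbol of the
  image, and a colour. Storing the symbol of the image makes the map onto \<open>W\<close> a one-block code.
\<close>

locale recoding = local_presentation A M R \<Phi>
  for A :: "'a set" and M :: "'g::group_add set" and R and \<Phi> :: "('g \<Rightarrow> 'a) \<Rightarrow> 'b" +
  fixes A\<^sub>W :: "'b set" and F :: "'g set" and \<eta> :: real and L :: nat
    and B :: "nat set" and d :: "nat \<Rightarrow> 'a \<times> 'b \<times> nat"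
  assumes finite_AW: "finite A\<^sub>W" and \<Phi>_AW: "\<And>x. x \<in> X \<Longrightarrow> \<Phi> x \<in> A\<^sub>W"
    and finite_F: "finite F" and zero_F: "0 \<in> F" and \<eta>_pos: "\<eta> > 0"
    and L_eq: "L = Suc (card F * card F)"
    and d: "bij_betw d B (A \<times> A\<^sub>W \<times> {..L})"
begin

definition \<alpha> :: "('g \<Rightarrow> nat) \<Rightarrow> ('g \<Rightarrow> 'a)" where "\<alpha> x = (\<lambda>g. fst (d (x g)))"
definition \<beta> :: "('g \<Rightarrow> nat) \<Rightarrow> ('g \<Rightarrow> 'b)" where "\<beta> x = (\<lambda>g. fst (snd (d (x g))))"
definition \<tau> :: "('g \<Rightarrow> nat) \<Rightarrow> ('g \<Rightarrow> nat)" where "\<tau> x = (\<lambda>g. snd (snd (d (x g))))"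

definition local_rule :: "('g \<Rightarrow> nat) \<Rightarrow> bool" where
  "local_rule x \<longleftrightarrow> R (\<alpha> x) \<and> \<beta> x 0 = \<Phi> (\<alpha> x) \<and> cover_rule F \<eta> (\<tau> x) \<and> canonical F (\<tau> x) (\<alpha> x)"

definition Y :: "('g \<Rightarrow> nat) set" where
  "Y = {x. range x \<subseteq> B \<and> (\<forall>g. local_rule (shift g x))}"

lemma finite_B: "finite B"
  using d finite_A finite_AW by (metis bij_betw_finite finite_SigmaI finite_atMost)

lemma depends_on_local_rule: "depends_on (M \<union> F \<union> (uminus ` F + F)) local_rule"
  unfolding depends_on_def
proof (intro allI impI)
  fix x y :: "'g \<Rightarrow> nat" assume xy: "\<forall>m\<in>M \<union> F \<union> (uminus ` F + F). x m = y m"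
  have "R (\<alpha> x) = R (\<alpha> y)" "\<Phi> (\<alpha> x) = \<Phi> (\<alpha> y)"
    using xy by (auto simp: \<alpha>_def intro!: depends_onD[OF R_window] depends_onD[OF \<Phi>_window])
  moreover have "\<beta> x 0 = \<beta> y 0" using xy zero_M by (simp add: \<beta>_def)
  moreover have "cover_rule F \<eta> (\<tau> x) = cover_rule F \<eta> (\<tau> y)"
    using xy by (intro depends_onD[OF depends_on_cover_rule]) (simp add: \<tau>_def)
  moreover have "canonical F (\<tau> x) (\<alpha> x) = canonical F (\<tau> y) (\<alpha> y)"
    using xy zero_M by (intro canonical_cong) (auto simp: \<tau>_def \<alpha>_def)
  ultimately show "local_rule x = local_rule y" by (simp add: local_rule_def)
qed

lemma finite_window: "finite (M \<union> F \<union> (uminus ` F + F))"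
  using finite_M finite_F by (auto intro: finite_set_plus)

lemma sft_Y: "sft B Y"
  unfolding Y_def using finite_B finite_window depends_on_local_rule by (rule sft_local_rule)

lemma subshift_Y: "subshift B Y"
  unfolding Y_def using finite_B finite_window depends_on_local_rule by (rule subshift_local_rule)

lemma shift_layers: "\<alpha> (shift g x) = shift g (\<alpha> x)" "\<beta> (shift g x) = shift g (\<beta> x)"
    "\<tau> (shift g x) = shift g (\<tau> x)"
  by (auto simp: \<alpha>_def \<beta>_def \<tau>_def shift_def)

lemma layersD:
  assumes "x \<in> Y"
  shows "x g \<in> B" "\<alpha> x g \<in> A" "\<beta> x g \<in> A\<^sub>W" "\<tau> x g \<le> L"
    "\<alpha> x \<in> X" "\<beta> x g = \<Phi> (shift g (\<alpha> x))" "cover_rule F \<eta> (shift g (\<tau> x))"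
    "canonical F (shift g (\<tau> x)) (shift g (\<alpha> x))"
proof -
  show xB: "x g \<in> B" for g using assms by (auto simp: Y_def)
  have "d (x g) \<in> A \<times> A\<^sub>W \<times> {..L}" for g using d xB by (rule bij_betw_apply)
  then show A: "\<alpha> x g \<in> A" "\<beta> x g \<in> A\<^sub>W" "\<tau> x g \<le> L" for g
    by (auto simp: \<alpha>_def \<beta>_def \<tau>_def mem_Times_iff)
  have "local_rule (shift g x)" for g using assms by (simp add: Y_def)
  then have r: "R (shift g (\<alpha> x)) \<and> shift g (\<beta> x) 0 = \<Phi> (shift g (\<alpha> x)) \<and>
      cover_rule F \<eta> (shift g (\<tau> x)) \<and> canonical F (shift g (\<tau> x)) (shift g (\<alpha> x))" for g
    by (simp add: local_rule_def shift_layers)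
  show "\<alpha> x \<in> X" using r A by (auto simp: X_def)
  show "\<beta> x g = \<Phi> (shift g (\<alpha> x))" using r[of g] by (simp add: shift_def)
  show "cover_rule F \<eta> (shift g (\<tau> x))" "canonical F (shift g (\<tau> x)) (shift g (\<alpha> x))"
    using r by blast+
qed

text \<open>
  Nothing of the image is lost: a cover exists, and over each point of the image there is a
  configuration that is canonical with respect to it.
\<close>

lemma \<beta>_image: "\<beta> ` Y = (\<lambda>x g. \<Phi> (shift g x)) ` X"
proof
  show "\<beta> ` Y \<subseteq> (\<lambda>x g. \<Phi> (shift g x)) ` X"
  proof
    fix w assume "w \<in> \<beta> ` Y"
    then obtain x where x: "x \<in> Y" "w = \<beta> x" by blast
    then have "w = (\<lambda>g. \<Phi> (shift g (\<alpha> x)))" using layersD(6) by blast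
    then show "w \<in> (\<lambda>x g. \<Phi> (shift g x)) ` X" using layersD(5)[OF x(1)] by blast
  qed
  show "(\<lambda>x g. \<Phi> (shift g x)) ` X \<subseteq> \<beta> ` Y"
  proof clarify
    fix x assume x: "x \<in> X"
    obtain t where t: "\<And>g. t g \<le> L" "\<And>g. cover_rule F \<eta> (shift g t)"
      using coloured_cover_exists[of F \<eta>] finite_F zero_F \<eta>_pos unfolding L_eq by blast
    obtain y where y: "y \<in> X" "\<And>g. \<Phi> (shift g y) = \<Phi> (shift g x)"
        "\<And>g. canonical F (shift g t) (shift g y)"
      using canonical_representative_exists[OF x t(2)] by metis
    define z where "z g = inv_into B d (y g, \<Phi> (shift g y), t g)" for g
    have mem: "(y g, \<Phi> (shift g y), t g) \<in> A \<times> A\<^sub>W \<times> {..L}" for g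
      using y(1) t(1)[of g] \<Phi>_AW[OF shift_mem_X[OF y(1)]] by (auto simp: X_def)
    have dz: "d (z g) = (y g, \<Phi> (shift g y), t g)" and zB: "z g \<in> B" for g
      using mem[of g] d by (simp_all add: z_def bij_betw_inv_into_right bij_betw_def inv_into_into)
    have layers: "\<alpha> z = y" "\<beta> z = (\<lambda>g. \<Phi> (shift g y))" "\<tau> z = t"
      by (auto simp: \<alpha>_def \<beta>_def \<tau>_def dz)
    have "local_rule (shift g z)" for g
      using y t(2) unfolding local_rule_def shift_layers layers
      by (simp add: X_def shift_def[of g "\<lambda>g. \<Phi> (shift g x)"])
    then have "z \<in> Y" using zB by (auto simp: Y_def)
    moreover have "\<beta> z = (\<lambda>g. \<Phi> (shift g x))" using layers(2) y(2) by simp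
    ultimately show "(\<lambda>g. \<Phi> (shift g x)) \<in> \<beta> ` Y" by (metis imageI)
  qed
qed

lemma one_block_code_\<beta>:
  assumes W: "subshift A\<^sub>W W" "W = (\<lambda>x g. \<Phi> (shift g x)) ` X"
  shows "one_block_code B Y A\<^sub>W W \<beta>"
proof -
  have p: "(\<lambda>b. fst (snd (d b))) \<in> B \<rightarrow> A\<^sub>W"
    using bij_betw_apply[OF d] by (force simp: mem_Times_iff)
  have \<beta>: "\<beta> = (\<lambda>x g. fst (snd (d (x g))))" by (auto simp: \<beta>_def)
  have "continuous_map (subtopology (full_shift B) Y) (subtopology (full_shift A\<^sub>W) W) \<beta>"
    unfolding \<beta>
  proof (rule continuous_map_one_block[OF _ p])
    show "range x \<subseteq> B" if "x \<in> Y" for x using layersD(1)[OF that] by auto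
    show "(\<lambda>g. fst (snd (d (x g)))) \<in> W" if "x \<in> Y" for x
      using \<beta>_image that W(2) by (auto simp: \<beta>)
  qed
  then have "factor_map B Y A\<^sub>W W \<beta>"
    using subshift_Y W \<beta>_image by (simp add: factor_map_def shift_layers)
  moreover have "\<exists>p\<in>B \<rightarrow> A\<^sub>W. \<forall>x\<in>Y. \<forall>g. \<beta> x g = p (x g)"
    using p by (intro bexI[of _ "\<lambda>b. fst (snd (d b))"]) (auto simp: \<beta>)
  ultimately show ?thesis by (simp add: one_block_code_def)
qed

text \<open>
  The limit of the error terms of \<open>ln_card_patterns_gap\<close>, divided by \<open>card V\<close>, as \<open>V\<close> runs through a
  Folner sequence. The parameter \<open>\<theta>\<close> is the weight in the count of the colour layers.
\<close>

definition gap_bound :: "real \<Rightarrow> real" where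
  "gap_bound \<theta> = real L * \<theta> + ln (1 / \<theta>) / (\<eta> * card F) + ln (card A + 1) *
     (\<eta> + card K * card {f \<in> F. \<exists>k\<in>K. k + f \<notin> F} / (\<eta> * card F))"

text \<open>
  The bound of \<open>card_non_core_points_le\<close> on the number of points of \<open>V\<close> that are no core points.
\<close>

definition bad_bound :: "'g set \<Rightarrow> real" where
  "bad_bound V = \<eta> * card (uminus ` F + V)
      + card K * card {f \<in> F. \<exists>k\<in>K. k + f \<notin> F} * (card (F + (uminus ` F + (K + V))) / (\<eta> * card F))
      + card (F + uminus ` F) * card (((F + uminus ` F) + V) - V)"

text \<open>
  A pattern on \<open>V\<close> is determined by its image, by the colours on \<open>uminus ` F + V\<close>, which fix the cells
  of all tiles inside \<open>V\<close>, and by the symbols at the points of \<open>V\<close> that are no core points. The three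
  summands on the right count these three data.
\<close>

lemma ln_card_patterns_gap:
  fixes \<theta> :: real
  assumes X': "subshift B X'" "X' \<subseteq> Y" "X' \<noteq> {}" and V: "finite V" and \<theta>: "0 < \<theta>" "\<theta> \<le> 1"
  shows "ln (card (patterns V X')) \<le> ln (card (patterns V (\<beta> ` X')))
     + (real L * \<theta> * card (uminus ` F + V)
        + card (F + (uminus ` F + V)) / (\<eta> * card F) * ln (1 / \<theta>))
     + ln (card A + 1) * bad_bound V"
proof -
  define V' where "V' = uminus ` F + V"
  have V': "finite V'" using V finite_F by (auto simp: V'_def intro: finite_set_plus)
  define \<kappa> where "\<kappa> = card (F + V') / (\<eta> * card F)"
  define bad where "bad x = V - core_points K F (\<tau> x) V" for x
  define f where "f x = (restr (\<beta> x) V, restr (\<tau> x) V')" for x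
  define g where "g x = restr (\<alpha> x) (bad x)" for x
  \<comment> \<open>The summand 1 makes a positive also for an empty alphabet.\<close>
  define a where "a = card A + 1"
  define n where "n = nat \<lfloor>bad_bound V\<rfloor>"
  have pos: "0 < \<eta> * real (card F)"
    using finite_F zero_F \<eta>_pos by (intro mult_pos_pos) (auto simp: card_gt_0_iff)
  have Y: "x \<in> Y" if "x \<in> X'" for x using that X'(2) by blast
  have bad: "real (card (bad x)) \<le> bad_bound V" if "x \<in> X'" for x
    unfolding bad_def bad_bound_def
    using layersD(7)[OF Y[OF that]] \<eta>_pos finite_F _ V finite_K zero_K minus_K
    by (rule card_non_core_points_le) (use zero_F in auto)
  have bad_n: "card (bad x) \<le> n" if "x \<in> X'" for x
    using bad[OF that] by (simp add: n_def le_nat_floor)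
  have n: "real n \<le> bad_bound V"
  proof -
    obtain x where "x \<in> X'" using X'(3) by blast
    from bad[OF this] have "0 \<le> bad_bound V" using of_nat_0_le_iff[of "card (bad x)"] by linarith
    then show ?thesis by (simp add: n_def)
  qed
  have fin\<beta>: "finite ((\<lambda>x. restr (\<beta> x) V) ` X')" (is "finite ?P\<beta>")
    using finite_restr_image[OF finite_AW V, of "\<beta> ` X'"] layersD(3)[OF Y]
    by (auto simp: image_image)
  have fin\<tau>: "finite ((\<lambda>x. restr (\<tau> x) V') ` X')" (is "finite ?P\<tau>")
    using finite_restr_image[OF finite_atMost V', of "\<tau> ` X'" L] layersD(4)[OF Y]
    by (auto simp: image_image)
  have sub: "f ` X' \<subseteq> ?P\<beta> \<times> ?P\<tau>" by (auto simp: f_def)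
  have finf: "finite (f ` X')" using sub fin\<beta> fin\<tau> by (meson finite_SigmaI finite_subset)
  have fibre: "card (g ` {x \<in> X'. f x = u}) \<le> a ^ n \<and> finite (g ` {x \<in> X'. f x = u})" for u
  proof (cases "\<exists>x0\<in>X'. f x0 = u")
    case True
    then obtain x0 where x0: "x0 \<in> X'" "f x0 = u" by blast
    \<comment> \<open>Within a fibre of f the colours are fixed, hence so is the domain on which g records symbols.\<close>
    have same: "bad x = bad x0" if "x \<in> X'" "f x = u" for x
    proof -
      have "\<tau> x d = \<tau> x0 d" if "d \<in> uminus ` F + V" for d
        using \<open>f x = u\<close> x0(2) that by (auto simp: f_def restr_eq_iff V'_def)
      then show ?thesis unfolding bad_def by (metis core_points_cong)
    qed
    have eq: "g ` {x \<in> X'. f x = u} = (\<lambda>x. restr x (bad x0)) ` (\<alpha> ` {x \<in> X'. f x = u})"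
      using same by (auto simp: g_def image_image intro!: image_cong)
    have fb: "finite (bad x0)" using V by (simp add: bad_def)
    have rng: "range x \<subseteq> A" if "x \<in> \<alpha> ` {x \<in> X'. f x = u}" for x
      using that layersD(2)[OF Y] by auto
    have "card (g ` {x \<in> X'. f x = u}) \<le> card A ^ card (bad x0)"
      unfolding eq using finite_A fb rng by (rule card_restr_image_le)
    also have "\<dots> \<le> a ^ card (bad x0)" by (rule power_mono) (auto simp: a_def)
    also have "\<dots> \<le> a ^ n" using bad_n[OF x0(1)] by (intro power_increasing) (auto simp: a_def)
    finally have "card (g ` {x \<in> X'. f x = u}) \<le> a ^ n" .
    moreover have "finite (g ` {x \<in> X'. f x = u})"
      unfolding eq using finite_A fb rng by (rule finite_restr_image)
    ultimately show ?thesis by simp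
  next
    case False
    then have "{x \<in> X'. f x = u} = {}" by blast
    then show ?thesis by (simp only: image_empty card.empty finite.emptyI le0 simp_thms)
  qed
  have inj: "restr x V = restr y V" if xy: "x \<in> X'" "y \<in> X'" "(f x, g x) = (f y, g y)" for x y
  proof -
    have \<beta>: "\<beta> x v = \<beta> y v" if "v \<in> V" for v using xy that by (auto simp: f_def restr_eq_iff)
    have \<tau>: "\<tau> x v = \<tau> y v" if "v \<in> uminus ` F + V" for v
      using xy that by (auto simp: f_def restr_eq_iff V'_def)
    have "V \<subseteq> uminus ` F + V" using zero_F by (auto simp: set_plus_uminus_iff intro!: bexI[of _ 0])
    then have \<tau>': "\<tau> x v = \<tau> y v" if "v \<in> V" for v using \<tau> that by blast
    have "bad y = bad x" unfolding bad_def using core_points_cong[of F V "\<tau> x" "\<tau> y"] \<tau> by metis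
    then have off: "\<alpha> x v = \<alpha> y v" if "v \<in> bad x" for v using xy that by (auto simp: g_def restr_eq_iff)
    have \<alpha>: "\<alpha> x v = \<alpha> y v" if "v \<in> V" for v
    proof (rule canonical_determined[OF _ _ _ _ _ _ that])
      show "cover_rule F \<eta> (shift g (\<tau> x))" for g using layersD(7)[OF Y[OF xy(1)]] .
      show "\<tau> x d = \<tau> y d" if "d \<in> uminus ` F + V" for d using \<tau> that .
      show "canonical F (shift g (\<tau> x)) (shift g (\<alpha> x))" for g using layersD(8)[OF Y[OF xy(1)]] .
      show "canonical F (shift g (\<tau> y)) (shift g (\<alpha> y))" for g using layersD(8)[OF Y[OF xy(2)]] .
      show "\<Phi> (shift g (\<alpha> x)) = \<Phi> (shift g (\<alpha> y))" if "g \<in> V" for g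
        using \<beta>[OF that] layersD(6)[OF Y[OF xy(1)]] layersD(6)[OF Y[OF xy(2)]] by simp
      show "\<alpha> x g = \<alpha> y g" if "g \<in> V - core_points K F (\<tau> x) V" for g
        using off that by (simp add: bad_def)
    qed
    have "x v = y v" if "v \<in> V" for v
    proof -
      have "d (x v) = d (y v)"
        using \<alpha>[OF that] \<beta>[OF that] \<tau>'[OF that] by (simp add: \<alpha>_def \<beta>_def \<tau>_def prod_eq_iff)
      then show ?thesis
        using d layersD(1)[OF Y[OF xy(1)]] layersD(1)[OF Y[OF xy(2)]]
        by (meson bij_betw_def inj_onD)
    qed
    then show ?thesis by (simp add: restr_eq_iff)
  qed
  have "patterns V X' = (\<lambda>x. restr x V) ` X'"
  proof
    show "patterns V X' \<subseteq> (\<lambda>x. restr x V) ` X'"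
      using subshiftD(3)[OF X'(1)] by (auto simp: patterns_def)
    show "(\<lambda>x. restr x V) ` X' \<subseteq> patterns V X'"
      unfolding patterns_def by clarify (metis shift_zero)
  qed
  then have "card (patterns V X') \<le> card ((\<lambda>x. (f x, g x)) ` X')"
  proof (simp only:, intro card_image_le_if_determines inj)
    have "(\<lambda>x. (f x, g x)) ` X' \<subseteq> Sigma (f ` X') (\<lambda>u. g ` {x \<in> X'. f x = u})" by auto
    then show "finite ((\<lambda>x. (f x, g x)) ` X')"
      using finf fibre by (meson finite_SigmaI finite_subset)
  qed
  also have "\<dots> \<le> card (f ` X') * a ^ n"
    using finf fibre by (intro card_image_Pair_le) auto
  also have "\<dots> \<le> (card (patterns V (\<beta> ` X')) * card ?P\<tau>) * a ^ n"
  proof (rule mult_right_mono)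
    have "?P\<beta> \<subseteq> patterns V (\<beta> ` X')"
      unfolding patterns_def by clarify (metis imageI shift_zero)
    moreover have "finite (patterns V (\<beta> ` X'))"
      using finite_AW V layersD(3)[OF Y] by (intro finite_patterns) auto
    ultimately have "card ?P\<beta> \<le> card (patterns V (\<beta> ` X'))" by (intro card_mono)
    moreover have "card (f ` X') \<le> card (?P\<beta> \<times> ?P\<tau>)"
      using sub fin\<beta> fin\<tau> by (intro card_mono) auto
    ultimately show "card (f ` X') \<le> card (patterns V (\<beta> ` X')) * card ?P\<tau>"
      by (simp add: card_cartesian_product) (meson le_trans mult_le_mono1)
  qed simp
  finally have main: "card (patterns V X') \<le> card (patterns V (\<beta> ` X')) * card ?P\<tau> * a ^ n" .
  have \<tau>_count: "real (card ?P\<tau>) \<le> exp (real L * \<theta> * card V' + \<kappa> * ln (1 / \<theta>))"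
  proof -
    have "real (card ((\<lambda>t. restr t V') ` (\<tau> ` X'))) \<le> exp (real L * \<theta> * card V' + \<kappa> * ln (1 / \<theta>))"
    proof (rule card_sparse_restr_le[OF V' \<theta>])
      fix t assume "t \<in> \<tau> ` X'"
      then obtain x where x: "x \<in> X'" "t = \<tau> x" by blast
      show "t g \<le> L" for g using layersD(4)[OF Y[OF x(1)]] x(2) by simp
      have "real (card {c \<in> V'. 0 < t c}) * (\<eta> * card F) \<le> card (F + V')"
        using layersD(7)[OF Y[OF x(1)]] finite_F V' unfolding x(2) by (rule card_centres_le)
      then show "real (card {v \<in> V'. 0 < t v}) \<le> \<kappa>"
        using pos by (simp add: \<kappa>_def pos_le_divide_eq)
    qed
    then show ?thesis by (simp add: image_image)
  qed
  have "0 < card (patterns V X')" "0 < card (patterns V (\<beta> ` X'))"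
  proof -
    have "finite (patterns V X')"
      using finite_B V layersD(1)[OF Y] by (intro finite_patterns) auto
    moreover have "finite (patterns V (\<beta> ` X'))"
      using finite_AW V layersD(3)[OF Y] by (intro finite_patterns) auto
    moreover have "patterns V X' \<noteq> {}" "patterns V (\<beta> ` X') \<noteq> {}"
      using X'(3) by (auto simp: patterns_def)
    ultimately show "0 < card (patterns V X')" "0 < card (patterns V (\<beta> ` X'))"
      by (simp_all add: card_gt_0_iff)
  qed
  moreover have "0 < card ?P\<tau>" using fin\<tau> X'(3) by (simp add: card_gt_0_iff)
  ultimately have "ln (card (patterns V X')) \<le> ln (real (card (patterns V (\<beta> ` X')) * card ?P\<tau> * a ^ n))"
    using main by (subst ln_le_cancel_iff) (auto simp: a_def simp del: of_nat_mult)
  also have "\<dots> = ln (card (patterns V (\<beta> ` X'))) + ln (card ?P\<tau>) + n * ln a"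
    using \<open>0 < card (patterns V (\<beta> ` X'))\<close> \<open>0 < card ?P\<tau>\<close>
    by (simp add: ln_mult ln_realpow a_def)
  also have "\<dots> \<le> ln (card (patterns V (\<beta> ` X'))) + (real L * \<theta> * card V' + \<kappa> * ln (1 / \<theta>)) + ln a * bad_bound V"
  proof (intro add_mono order_refl)
    show "ln (card ?P\<tau>) \<le> real L * \<theta> * card V' + \<kappa> * ln (1 / \<theta>)"
      using \<tau>_count \<open>0 < card ?P\<tau>\<close> by (metis exp_gt_zero ln_exp ln_le_cancel_iff of_nat_0_less_iff)
    show "n * ln a \<le> ln a * bad_bound V"
      using n by (subst mult.commute) (auto simp: a_def intro!: mult_left_mono)
  qed
  finally show ?thesis by (simp add: V'_def \<kappa>_def a_def add.commute)
qed

lemma entropy_gap_le: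
  fixes \<theta> :: real and V :: "nat \<Rightarrow> 'g set"
  assumes X': "subshift B X'" "X' \<subseteq> Y" and \<theta>: "0 < \<theta>" "\<theta> \<le> 1"
    and folner: "folner_sequence V"
  shows "entropy X' - entropy (\<beta> ` X') \<le> gap_bound \<theta>"
proof (cases "X' = {}")
  case True
  have "ln (1 / \<theta>) \<ge> 0" using \<theta> by simp
  then have "gap_bound \<theta> \<ge> 0" unfolding gap_bound_def using \<theta> \<eta>_pos
    by (intro add_nonneg_nonneg mult_nonneg_nonneg divide_nonneg_nonneg) auto
  then show ?thesis using True by (simp add: entropy_def)
next
  case False
  define r where "r J n = real (card (J + V n)) / card (V n)" for J n
  define J where "J = F + uminus ` F"
  define rim where "rim = real (card K * card {f \<in> F. \<exists>k\<in>K. k + f \<notin> F})"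
  define e where "e n = card ((J + V n) - V n) / card (V n)" for n
  have r: "r I \<longlonglongrightarrow> 1" if "finite I" "I \<noteq> {}" for I
    unfolding r_def using folner that by (rule folner_set_plus_ratio)
  have ne: "finite (uminus ` F)" "uminus ` F \<noteq> {}" "finite J" "J \<noteq> {}" "finite (J + K)" "J + K \<noteq> {}"
  proof -
    show F': "finite (uminus ` F)" "uminus ` F \<noteq> {}" using finite_F zero_F by auto
    show J: "finite J" unfolding J_def using finite_F F'(1) by (rule finite_set_plus)
    then show "finite (J + K)" using finite_K by (rule finite_set_plus)
    have "0 + - 0 \<in> J" unfolding J_def using zero_F by (intro set_plus_intro imageI)
    then show "J \<noteq> {}" "J + K \<noteq> {}" using zero_K set_plus_intro by blast+
  qed
  have e: "e \<longlonglongrightarrow> 0" unfolding e_def using folner ne(3,4) by (rule folner_set_plus_diff)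
  define u where "u n = real L * \<theta> * r (uminus ` F) n + ln (1 / \<theta>) / (\<eta> * card F) * r J n
      + ln (card A + 1) * (\<eta> * r (uminus ` F) n + rim / (\<eta> * card F) * r (J + K) n + card J * e n)" for n
  have "u \<longlonglongrightarrow> real L * \<theta> * 1 + ln (1 / \<theta>) / (\<eta> * card F) * 1
      + ln (card A + 1) * (\<eta> * 1 + rim / (\<eta> * card F) * 1 + card J * 0)"
    unfolding u_def using r ne e by (intro tendsto_intros) auto
  then have u: "u \<longlonglongrightarrow> gap_bound \<theta>" by (simp add: gap_bound_def rim_def)
  have "(\<lambda>n. ln (real (card (patterns (V n) X'))) / real (card (V n))) \<longlonglongrightarrow> entropy X'"
    using subshiftD[OF X'(1)] False folner by (intro entropy_eq_limit) auto
  moreover have "(\<lambda>n. ln (real (card (patterns (V n) (\<beta> ` X')))) / real (card (V n)) + u n)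
      \<longlonglongrightarrow> entropy (\<beta> ` X') + gap_bound \<theta>"
    using finite_AW layersD(3) X'(2) False folner by (intro tendsto_add u entropy_eq_limit) auto
  moreover have "\<forall>\<^sub>F n in sequentially. ln (real (card (patterns (V n) X'))) / real (card (V n))
      \<le> ln (real (card (patterns (V n) (\<beta> ` X')))) / real (card (V n)) + u n"
    using folner_sequenceD(3)[OF folner]
  proof eventually_elim
    case (elim n)
    define N where "N = real (card (V n))"
    have N: "N > 0" using elim by (simp add: N_def)
    have r_eq: "real (card (I + V n)) = r I n * N" for I using N by (simp add: r_def N_def)
    have e_eq: "real (card ((J + V n) - V n)) = e n * N" using N by (simp add: e_def N_def)
    have assoc: "F + (uminus ` F + V n) = J + V n" "F + (uminus ` F + (K + V n)) = (J + K) + V n"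
      by (simp_all add: J_def add.assoc)
    have "ln (card (patterns (V n) X')) \<le> ln (card (patterns (V n) (\<beta> ` X')))
     + (real L * \<theta> * card (uminus ` F + V n)
        + card (F + (uminus ` F + V n)) / (\<eta> * card F) * ln (1 / \<theta>))
     + ln (card A + 1) * bad_bound (V n)"
      using X' False folner_sequenceD(1)[OF folner] \<theta> by (rule ln_card_patterns_gap)
    also have "\<dots> = ln (card (patterns (V n) (\<beta> ` X'))) + u n * N"
      unfolding bad_bound_def assoc u_def J_def[symmetric] r_eq e_eq rim_def
      by (simp add: e_eq algebra_simps)
    finally show ?case using N by (simp add: N_def[symmetric] field_simps)
  qed
  ultimately have "entropy X' \<le> entropy (\<beta> ` X') + gap_bound \<theta>"
    using tendsto_le[OF sequentially_bot] by blast
  then show ?thesis by simp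
qed

end

section \<open>Choice of the parameters\<close>

lemma card_folner_at_top:
  fixes V :: "nat \<Rightarrow> 'g::group_add set"
  assumes V: "folner_sequence V" and inf: "infinite (UNIV :: 'g set)"
  shows "filterlim (\<lambda>n. real (card (V n))) at_top sequentially"
  unfolding filterlim_at_top
proof
  fix Z :: real
  obtain S :: "'g set" where S: "finite S" "card S = nat \<lceil>Z\<rceil>"
    using infinite_arbitrarily_large[OF inf] by blast
  have "\<forall>\<^sub>F n in sequentially. \<forall>s\<in>S. s \<in> V n"
    using S(1) folner_sequenceD(2)[OF V] by (simp add: eventually_ball_finite)
  then show "\<forall>\<^sub>F n in sequentially. Z \<le> real (card (V n))"
  proof eventually_elim
    case (elim n)
    then have "card S \<le> card (V n)" using folner_sequenceD(1)[OF V] by (intro card_mono) auto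
    then show ?case using S(2) by linarith
  qed
qed

lemma folner_rim:
  assumes V: "folner_sequence V" and K: "finite K" "K \<noteq> {}"
  shows "(\<lambda>n. real (card {f \<in> V n. \<exists>k\<in>K. k + f \<notin> V n}) / card (V n)) \<longlonglongrightarrow> 0"
proof (rule tendsto_sandwich[OF _ _ tendsto_const])
  show "(\<lambda>n. real (card K) * (real (card ((K + V n) - V n)) / card (V n))) \<longlonglongrightarrow> 0"
    using tendsto_mult_right_zero[OF folner_set_plus_diff[OF assms]] by simp
  show "\<forall>\<^sub>F n in sequentially. real (card {f \<in> V n. \<exists>k\<in>K. k + f \<notin> V n}) / card (V n)
      \<le> real (card K) * (real (card ((K + V n) - V n)) / card (V n))"
    using card_boundary_le[OF K(1) folner_sequenceD(1)[OF V]]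
    by (intro always_eventually allI) (simp add: divide_right_mono flip: of_nat_mult)
qed auto

text \<open>
  First \<open>\<eta>\<close> is chosen to make \<open>a * \<eta>\<close> small. For \<open>F\<close> in the Folner sequence with \<open>N\<close> elements, and
  \<open>\<theta>\<close> equal to the inverse cube of \<open>N\<close>, the first term is about \<open>1 / N\<close>, since there are only about
  \<open>N * N\<close> colours; the second is \<open>3 * ln N / (\<eta> * N)\<close>; and the rim of \<open>F\<close> is small compared with \<open>N\<close>.
\<close>

lemma small_gap_parameters:
  fixes V :: "nat \<Rightarrow> 'g::group_add set" and K :: "'g set" and a \<epsilon> :: real
  assumes V: "folner_sequence V" and inf: "infinite (UNIV :: 'g set)"
    and K: "finite K" "K \<noteq> {}" and "a \<ge> 0" "\<epsilon> > 0"
  obtains F and \<eta> \<theta> :: real where "finite F" "0 \<in> F" "0 < \<eta>" "0 < \<theta>" "\<theta> \<le> 1"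
    "real (Suc (card F * card F)) * \<theta> + ln (1 / \<theta>) / (\<eta> * card F)
      + a * (\<eta> + card K * card {f \<in> F. \<exists>k\<in>K. k + f \<notin> F} / (\<eta> * card F)) < \<epsilon>"
proof -
  define \<eta> where "\<eta> = \<epsilon> / (2 * (a + 1))"
  have \<eta>: "\<eta> > 0" "a * \<eta> < \<epsilon>"
    using assms(5,6) by (auto simp: \<eta>_def field_simps add_pos_nonneg intro!: add_nonneg_pos)
  define N where "N n = real (card (V n))" for n
  define q where "q n = real (card {f \<in> V n. \<exists>k\<in>K. k + f \<notin> V n}) / N n" for n
  have N: "filterlim N at_top sequentially"
    unfolding N_def using V inf by (rule card_folner_at_top)
  have inv: "(\<lambda>n. inverse (N n)) \<longlonglongrightarrow> 0"
    using N by (rule tendsto_inverse_0_at_top)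
  have ln: "(\<lambda>n. ln (N n) / N n) \<longlonglongrightarrow> 0"
    using ln_x_over_x_tendsto_0 N by (rule filterlim_compose)
  have q: "q \<longlonglongrightarrow> 0" unfolding q_def N_def using V K by (rule folner_rim)
  define u where "u n = inverse (N n) + inverse (N n) ^ 3 + 3 / \<eta> * (ln (N n) / N n)
      + a * (\<eta> + card K / \<eta> * q n)" for n
  have "u \<longlonglongrightarrow> 0 + 0 ^ 3 + 3 / \<eta> * 0 + a * (\<eta> + card K / \<eta> * 0)"
    unfolding u_def by (intro tendsto_intros inv ln q)
  then have "\<forall>\<^sub>F n in sequentially. u n < \<epsilon>"
    using \<eta>(2) by (intro order_tendstoD(2)) auto
  moreover have "\<forall>\<^sub>F n in sequentially. 1 \<le> N n"
    using N by (auto simp: filterlim_at_top)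
  ultimately have "\<forall>\<^sub>F n in sequentially. u n < \<epsilon> \<and> 1 \<le> N n \<and> 0 \<in> V n"
    using folner_sequenceD(2)[OF V, of 0] by eventually_elim auto
  then obtain n where n: "u n < \<epsilon>" "1 \<le> N n" "0 \<in> V n"
    using eventually_happens'[OF sequentially_bot] by blast
  define \<theta> where "\<theta> = inverse (N n) ^ 3"
  show thesis
  proof (rule that[of "V n" \<eta> \<theta>])
    have eq: "real (Suc (card (V n) * card (V n))) * \<theta> = inverse (N n) + inverse (N n) ^ 3"
      using n(2) by (simp add: \<theta>_def N_def[symmetric] field_simps power3_eq_cube)
    have eq2: "ln (1 / \<theta>) / (\<eta> * card (V n)) = 3 / \<eta> * (ln (N n) / N n)"
    proof -
      have "1 / \<theta> = N n ^ 3" by (simp add: \<theta>_def power_inverse divide_inverse)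
      then have "ln (1 / \<theta>) = 3 * ln (N n)" using n(2) by (simp only: ln_realpow of_nat_numeral)
      then show ?thesis by (simp add: N_def)
    qed
    have eq3: "card K * card {f \<in> V n. \<exists>k\<in>K. k + f \<notin> V n} / (\<eta> * card (V n)) = card K / \<eta> * q n"
      by (simp add: q_def N_def)
    show "real (Suc (card (V n) * card (V n))) * \<theta> + ln (1 / \<theta>) / (\<eta> * card (V n))
      + a * (\<eta> + card K * card {f \<in> V n. \<exists>k\<in>K. k + f \<notin> V n} / (\<eta> * card (V n))) < \<epsilon>"
      using n(1) unfolding eq eq2 eq3 u_def .
  qed (use n \<eta> folner_sequenceD(1)[OF V] in \<open>auto simp: \<theta>_def power_le_one inverse_le_1_iff\<close>)
qed

text \<open>
  The block map has to be defined for all configurations: \<open>\<Phi> x\<close> is the symbol at 0 of the image of any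
  point of \<open>X\<close> that agrees with \<open>x\<close> on the window, and an arbitrary symbol if there is none.
\<close>

lemma sofic_obtain_local_presentation:
  assumes "sofic A\<^sub>W W"
  obtains A :: "nat set" and M :: "'g::group_add set" and R and \<Phi> :: "('g \<Rightarrow> nat) \<Rightarrow> 'b"
  where "local_presentation A M R \<Phi>"
    "W = (\<lambda>x g. \<Phi> (shift g x)) ` local_presentation.X A R"
proof -
  obtain A :: "nat set" and X \<phi> where AX: "sft A X" and fac: "factor_map A X A\<^sub>W W \<phi>"
    using assms by (auto simp: sofic_def)
  obtain M1 R where R: "finite M1" "depends_on M1 R" "X = {x. range x \<subseteq> A \<and> (\<forall>g. R (shift g x))}"
    using sft_obtain_local_rule[OF AX] by blast
  obtain M2 where M2: "finite M2"
      "\<And>x y. x \<in> X \<Longrightarrow> y \<in> X \<Longrightarrow> (\<And>m. m \<in> M2 \<Longrightarrow> x m = y m) \<Longrightarrow> \<phi> x 0 = \<phi> y 0"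
    using factor_map_finite_window[OF fac] by blast
  define M where "M = M1 \<union> M2 \<union> {0}"
  define \<Phi> where "\<Phi> x = \<phi> (SOME z. z \<in> X \<and> (\<forall>m\<in>M. z m = x m)) 0" for x
  have \<Phi>: "\<Phi> x = \<phi> x 0" if "x \<in> X" for x
  proof -
    have "x \<in> X \<and> (\<forall>m\<in>M. x m = x m)" using that by simp
    then have "(SOME z. z \<in> X \<and> (\<forall>m\<in>M. z m = x m)) \<in> X \<and>
        (\<forall>m\<in>M. (SOME z. z \<in> X \<and> (\<forall>m\<in>M. z m = x m)) m = x m)"
      by (rule someI[of "\<lambda>z. z \<in> X \<and> (\<forall>m\<in>M. z m = x m)"])
    then show ?thesis unfolding \<Phi>_def using that by (intro M2(2)) (auto simp: M_def)
  qed
  have pres: "local_presentation A M R \<Phi>"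
  proof
    show "finite A" using AX by (simp add: sft_def)
    show "finite M" using R(1) M2(1) by (simp add: M_def)
    show "0 \<in> M" by (simp add: M_def)
    show "depends_on M R" using R(2) by (auto simp: depends_on_def M_def)
    show "depends_on M \<Phi>" unfolding depends_on_def
    proof (intro allI impI)
      fix x y :: "'g \<Rightarrow> nat" assume "\<forall>m\<in>M. x m = y m"
      then have "(\<lambda>z. z \<in> X \<and> (\<forall>m\<in>M. z m = x m)) = (\<lambda>z. z \<in> X \<and> (\<forall>m\<in>M. z m = y m))" by auto
      then show "\<Phi> x = \<Phi> y" by (simp add: \<Phi>_def)
    qed
  qed
  have X_eq: "local_presentation.X A R = X"
    unfolding local_presentation.X_def[OF pres] R(3) ..
  have "\<phi> x = (\<lambda>g. \<Phi> (shift g x))" if x: "x \<in> X" for x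
  proof
    fix g
    have "shift g x \<in> X" and "\<phi> (shift g x) = shift g (\<phi> x)"
      using fac x by (auto simp: factor_map_def subshift_def)
    then show "\<phi> x g = \<Phi> (shift g x)" by (simp add: \<Phi>) (simp add: shift_def)
  qed
  then have "W = (\<lambda>x g. \<Phi> (shift g x)) ` X"
    using fac unfolding factor_map_def by (metis (no_types, lifting) image_cong)
  then show thesis using that[OF pres] by (simp add: X_eq)
qed

theorem theorem5p1:
  fixes A\<^sub>W :: "'a set" and W :: "('g::group_add \<Rightarrow> 'a) set" and \<epsilon> :: real
  assumes "countable (UNIV :: 'g set)" and "infinite (UNIV :: 'g set)"
    and "amenable TYPE('g)"
    and "finite A\<^sub>W" and "sofic A\<^sub>W W"
    and "\<epsilon> > 0"
  shows "\<exists>(A :: nat set) (X :: ('g \<Rightarrow> nat) set) \<phi>.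
           sft A X \<and> one_block_code A X A\<^sub>W W \<phi> \<and> max_entropy_gap A X \<phi> < ereal \<epsilon>"
proof -
  obtain A :: "nat set" and M :: "'g set" and R and \<Phi> :: "('g \<Rightarrow> nat) \<Rightarrow> 'a"
    where pres: "local_presentation A M R \<Phi>"
      and W: "W = (\<lambda>x g. \<Phi> (shift g x)) ` local_presentation.X A R"
    by (rule sofic_obtain_local_presentation[OF assms(5)])
  interpret local_presentation A M R \<Phi> by (fact pres)
  have sub: "subshift A\<^sub>W W" using assms(5) by (simp add: sofic_def)
  obtain V :: "nat \<Rightarrow> 'g set" where V: "folner_sequence V"
    using assms(3) by (auto simp: amenable_def)
  have ne: "K \<noteq> {}" using zero_K by blast
  have ln_A: "0 \<le> ln (real (card A + 1))" by simp
  obtain F and \<eta> \<theta> :: real where F: "finite F" "0 \<in> F" "0 < \<eta>" "0 < \<theta>" "\<theta> \<le> 1"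
    "real (Suc (card F * card F)) * \<theta> + ln (1 / \<theta>) / (\<eta> * card F) + ln (real (card A + 1)) *
      (\<eta> + card K * card {f \<in> F. \<exists>k\<in>K. k + f \<notin> F} / (\<eta> * card F)) < \<epsilon>"
    by (rule small_gap_parameters[OF V assms(2) finite_K ne ln_A assms(6)])
  define L where "L = Suc (card F * card F)"
  obtain e :: "nat \<times> 'a \<times> nat \<Rightarrow> nat" where e: "inj_on e (A \<times> A\<^sub>W \<times> {..L})"
    using finite_imp_inj_to_nat_seg[of "A \<times> A\<^sub>W \<times> {..L}"] finite_A assms(4) by auto
  define B where "B = e ` (A \<times> A\<^sub>W \<times> {..L})"
  define d where "d = inv_into (A \<times> A\<^sub>W \<times> {..L}) e"
  have d: "bij_betw d B (A \<times> A\<^sub>W \<times> {..L})"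
    unfolding d_def B_def using e by (intro bij_betw_inv_into inj_on_imp_bij_betw)
  have \<Phi>_AW: "\<Phi> x \<in> A\<^sub>W" if "x \<in> X" for x
  proof -
    have "(\<lambda>g. \<Phi> (shift g x)) \<in> W" using W that by blast
    then have "\<Phi> (shift 0 x) \<in> A\<^sub>W" using subshiftD(2)[OF sub] by blast
    then show ?thesis by simp
  qed
  interpret recoding A M R \<Phi> A\<^sub>W F \<eta> L B d
    by unfold_locales (use assms(4) \<Phi>_AW F d in \<open>auto simp: L_def\<close>)
  have "max_entropy_gap B Y \<beta> \<le> ereal (gap_bound \<theta>)"
    unfolding max_entropy_gap_def
    using entropy_gap_le[OF _ _ F(4,5) V] by (intro SUP_least) auto
  moreover have "gap_bound \<theta> < \<epsilon>"
    using F(6) unfolding gap_bound_def unfolding L_def .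
  ultimately have "max_entropy_gap B Y \<beta> < ereal \<epsilon>"
    by (meson ereal_less_eq(3) le_less_trans less_ereal.simps(1))
  then show ?thesis using sft_Y one_block_code_\<beta>[OF sub W] by blast
qed

end
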